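(* Let $t\ge 1$ be a fixed integer. In the insertion-only streaming model, any (randomized, single-pass) algorithm that distinguishes whether a graph on $4n$ vertices is connected or is $\frac{1}{8t+1}$-far from being connected must use $\Omega(n^{1-1/t})$ bits of space.
   Context: In the insertion-only streaming model the input graph is given as a stream of edge insertions and no deletions. The algorithm is randomized and required to succeed with constant probability (e.g., $2/3$). A graph with $m$ edges is $\delta$-far from being connected if one has to modify (insert or delete) more than $\delta m$ edges to make it connected. *)

theory Defs
  imports "HOL-Probability.Probability"
begin

type_synonym edge = "nat set"

definition simple_graph :: "nat set \<Rightarrow> edge set \<Rightarrow> bool" where
  "simple_graph V E \<longleftrightarrow> finite V \<and> E \<subseteq> {{u, v} | u v. u \<in> V \<and> v \<in> V \<and> u \<noteq> v}"

definition connected_graph :: "nat set \<Rightarrow> edge set \<Rightarrow> bool" where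
  "connected_graph V E \<longleftrightarrow> (\<forall>u\<in>V. \<forall>v\<in>V. (u, v) \<in> {(x, y). {x, y} \<in> E}\<^sup>*)"

text \<open>The symmetric difference of the edge sets counts the edge insertions and deletions
  needed to turn one graph on \<open>V\<close> into another.\<close>

definition far_from_connected :: "real \<Rightarrow> nat set \<Rightarrow> edge set \<Rightarrow> bool" where
  "far_from_connected \<delta> V E \<longleftrightarrow>
     (\<forall>E'. simple_graph V E' \<and> connected_graph V E' \<longrightarrow>
        real (card ((E - E') \<union> (E' - E))) > \<delta> * real (card E))"

definition insertion_stream :: "edge list \<Rightarrow> edge set \<Rightarrow> bool" where
  "insertion_stream \<sigma> E \<longleftrightarrow> distinct \<sigma> \<and> set \<sigma> = E"

text \<open>A single-pass algorithm with all its coin tosses fixed. Its memory is a bit string;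
  \<open>update_mem D i e\<close> is the action on the memory when \<open>e\<close> arrives as the \<open>i\<close>-th stream element.\<close>

record det_streaming_alg =
  init_mem :: "bool list"
  update_mem :: "nat \<Rightarrow> edge \<Rightarrow> bool list \<Rightarrow> bool list"
  accepts :: "bool list \<Rightarrow> bool"

definition final_mem :: "det_streaming_alg \<Rightarrow> edge list \<Rightarrow> bool list" where
  "final_mem D \<sigma> = fold (\<lambda>(i, e). update_mem D i e) (List.enumerate 0 \<sigma>) (init_mem D)"

text \<open>A randomized algorithm is a probability distribution over deterministic ones. Since updates
  may depend on the position in the stream, this covers coins tossed afresh at every update as well
  as a random string that is drawn in advance and not charged to the space.\<close>

type_synonym streaming_alg = "det_streaming_alg pmf"

text \<open>Worst case over all inputs and all coin tosses. Every prefix of an insertion stream on \<open>V\<close> is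
  again such a stream, so bounding the final memory bounds the memory at all times.\<close>

definition uses_space :: "streaming_alg \<Rightarrow> nat set \<Rightarrow> nat \<Rightarrow> bool" where
  "uses_space A V s \<longleftrightarrow>
     (\<forall>D\<in>set_pmf A. \<forall>E \<sigma>. simple_graph V E \<and> insertion_stream \<sigma> E \<longrightarrow>
        length (final_mem D \<sigma>) \<le> s)"

definition distinguishes_connected :: "real \<Rightarrow> real \<Rightarrow> streaming_alg \<Rightarrow> nat set \<Rightarrow> bool" where
  "distinguishes_connected p \<delta> A V \<longleftrightarrow>
     (\<forall>E \<sigma>. simple_graph V E \<and> insertion_stream \<sigma> E \<longrightarrow>
        (connected_graph V E \<longrightarrow>
           measure_pmf.prob A {D. accepts D (final_mem D \<sigma>)} \<ge> p) \<and>
        (far_from_connected \<delta> V E \<longrightarrow>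
           measure_pmf.prob A {D. \<not> accepts D (final_mem D \<sigma>)} \<ge> p))"

end

theory Submission imports Defs begin

text \<open>
  The first part of the stream encodes a uniformly random \<open>X \<subseteq> {..<q}\<close>, the second part asks for the
  parities of \<open>X\<close> on \<open>m\<close> random disjoint sets of \<open>2 t\<close> coordinates. The graph is connected if all query
  bits differ from the parities, and has \<open>m\<close> additional components if they all agree; this is a
  form of the Boolean hidden hypermatching problem.

  The two cases are compared by flipping the query bits one at a time. Fix everything except the
  \<open>h\<close>-th set \<open>T\<close>: since the sets leave a linear number of coordinates free, \<open>T\<close> is a random \<open>2 t\<close>-subset
  of \<open>N = \<Omega>(n)\<close> coordinates on which \<open>X\<close> is uniform, and the flip is noticed only as far as the memory
  content after the first part predicts the parity of \<open>X \<inter> T\<close>. A hypercontractive moment bound for Walsh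
  polynomials of degree \<open>2 t\<close> limits this advantage to \<open>O((s / N) ^ t)\<close> for \<open>s\<close> bits of memory. Summed
  over the \<open>m = O(n)\<close> flips this is \<open>O(n (s / n) ^ t)\<close>, which must be bounded below by a constant.
\<close>

section \<open>Moments of Walsh polynomials\<close>

text \<open>From \<open>j\<close> to \<open>j + 1\<close> the left side grows by the factor
  \<open>(r - j) * (2 * r - 2 * j - 1) / ((2 * j + 1) * (j + 1))\<close>, the right side by
  \<open>2 * r * (r - j) / (j + 1)\<close>, which is at least as large.\<close>

lemma binomial_double_le: "(2 * r) choose (2 * j) \<le> (2 * r) ^ j * (r choose j)"
proof (induction j)
  case 0
  then show ?case by simp
next
  case (Suc j)
  show ?case
  proof (cases "j < r")
    case False
    then show ?thesis by (simp add: binomial_eq_0)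
  next
    case True
    define B where "B = real ((2 * r) choose (2 * j))"
    define b where "b = real (r choose j)"
    have s1: "real (Suc (2*j)) * real ((2*r) choose Suc (2*j)) = B * real (2*r - 2*j)"
      unfolding B_def by (metis binomial_absorb_comp binomial_absorption mult.commute of_nat_mult)
    have s2: "real (Suc (Suc (2*j))) * real ((2*r) choose Suc (Suc (2*j))) =
        real ((2*r) choose Suc (2*j)) * real (2*r - Suc (2*j))"
      by (metis binomial_absorb_comp binomial_absorption mult.commute of_nat_mult)
    have s3: "real (Suc j) * real (r choose Suc j) = b * real (r - j)"
      unfolding b_def by (metis binomial_absorb_comp binomial_absorption mult.commute of_nat_mult)
    have "real ((2 * j + 1) * (j + 1)) * real ((2*r) choose (2 * Suc j)) =
        (real (Suc (2*j)) * real ((2*r) choose Suc (2*j))) * real (2*r - Suc (2*j)) / 2"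
    proof -
      have "real ((2 * j + 1) * (j + 1)) * real ((2*r) choose (2 * Suc j)) =
          real (Suc (2*j)) * (real (Suc (Suc (2*j))) * real ((2*r) choose Suc (Suc (2*j)))) / 2"
        by (simp add: algebra_simps)
      then show ?thesis unfolding s2 by (simp only: mult.assoc)
    qed
    also have "\<dots> = B * (real (r - j) * real (2*r - Suc (2*j)))"
    proof -
      have "real (2*r - 2*j) = 2 * real (r - j)"
        by (simp only: diff_mult_distrib2[symmetric] of_nat_mult of_nat_numeral)
      then show ?thesis unfolding s1 by simp
    qed
    also have "\<dots> \<le> ((2 * real r) ^ j * b) * (real (r - j) * real (2*r - Suc (2*j)))"
    proof (rule mult_right_mono)
      show "B \<le> (2 * real r) ^ j * b"
        using of_nat_mono[OF Suc.IH, where 'a = real] by (simp add: B_def b_def)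
    qed simp
    also have "\<dots> = (2 * real r) ^ j * (real (Suc j) * real (r choose Suc j)) * real (2*r - Suc (2*j))"
      unfolding s3 by simp
    also have "\<dots> \<le> (2 * real r) ^ j * (real (Suc j) * real (r choose Suc j)) * (2 * real r * real (2 * j + 1))"
    proof (rule mult_left_mono)
      have "2*r - Suc (2*j) \<le> 2 * r * (2 * j + 1)" by (simp add: algebra_simps)
      from of_nat_mono[OF this, where 'a = real]
      show "real (2*r - Suc (2*j)) \<le> 2 * real r * real (2 * j + 1)"
        by (simp only: of_nat_mult of_nat_numeral)
    qed simp
    also have "\<dots> = real ((2 * j + 1) * (j + 1)) * ((2 * real r) ^ Suc j * real (r choose Suc j))"
      by (simp add: algebra_simps)
    finally have "real ((2*r) choose (2 * Suc j)) \<le> (2 * real r) ^ Suc j * real (r choose Suc j)"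
      by (subst (asm) mult_le_cancel_left_pos) (simp_all only: of_nat_0_less_iff, simp)
    then have "real ((2*r) choose (2 * Suc j)) \<le> real ((2 * r) ^ Suc j * (r choose Suc j))"
      by (simp only: of_nat_mult of_nat_power of_nat_numeral)
    then show ?thesis by (simp only: of_nat_le_iff)
  qed
qed

text \<open>One-coordinate case of the hypercontractive bound: odd powers of \<open>h\<close>
  cancel, and the even ones are compared term by term with the expansion of the right side.\<close>

lemma sum_power_two_point:
  fixes g h :: real
  shows "(g + h) ^ (2 * r) + (g - h) ^ (2 * r) \<le> 2 * (g\<^sup>2 + 2 * real r * h\<^sup>2) ^ r"
proof -
  define F where "F i = real ((2*r) choose i) * g ^ (2 * r - i)" for i
  have "(g + h) ^ (2 * r) + (g - h) ^ (2 * r) = (h + g) ^ (2 * r) + ((-h) + g) ^ (2 * r)"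
    by (simp add: add.commute)
  also have "\<dots> = (\<Sum>i\<le>2*r. F i * (h ^ i + (-h) ^ i))"
    unfolding binomial_ring F_def by (simp add: sum.distrib [symmetric] algebra_simps)
  also have "\<dots> = (\<Sum>i\<in>(\<lambda>j. 2 * j) ` {..r}. F i * (h ^ i + (-h) ^ i))"
  proof (rule sum.mono_neutral_right)
    show "\<forall>i\<in>{..2*r} - (\<lambda>j. 2 * j) ` {..r}. F i * (h ^ i + (-h) ^ i) = 0"
    proof
      fix i assume i: "i \<in> {..2*r} - (\<lambda>j. 2 * j) ` {..r}"
      then have "odd i" by (auto elim!: evenE)
      then show "F i * (h ^ i + (-h) ^ i) = 0" by simp
    qed
  qed auto
  also have "\<dots> = (\<Sum>j\<le>r. F (2 * j) * (h ^ (2 * j) + (-h) ^ (2 * j)))"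
    by (subst sum.reindex) (auto simp: inj_on_def)
  also have "\<dots> \<le> (\<Sum>j\<le>r. 2 * (real (r choose j) * (2 * real r * h\<^sup>2) ^ j * (g\<^sup>2) ^ (r - j)))"
  proof (rule sum_mono)
    fix j assume "j \<in> {..r}"
    have "real ((2*r) choose (2*j)) \<le> (2 * real r) ^ j * real (r choose j)"
      using of_nat_mono[OF binomial_double_le[of r j], where 'a = real] by simp
    then have "real ((2*r) choose (2*j)) * ((h\<^sup>2) ^ j * (g\<^sup>2) ^ (r - j)) \<le>
      (2 * real r) ^ j * real (r choose j) * ((h\<^sup>2) ^ j * (g\<^sup>2) ^ (r - j))"
      by (intro mult_right_mono) auto
    moreover have "F (2 * j) * (h ^ (2 * j) + (-h) ^ (2 * j)) =
        2 * (real ((2*r) choose (2*j)) * ((h\<^sup>2) ^ j * (g\<^sup>2) ^ (r - j)))"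
    proof -
      have "g ^ (2 * r - 2 * j) = (g\<^sup>2) ^ (r - j)"
        by (simp add: diff_mult_distrib2 power_mult[symmetric])
      then show ?thesis by (simp add: F_def power_mult)
    qed
    ultimately show "F (2 * j) * (h ^ (2 * j) + (-h) ^ (2 * j)) \<le>
        2 * (real (r choose j) * (2 * real r * h\<^sup>2) ^ j * (g\<^sup>2) ^ (r - j))"
      by (simp add: power_mult_distrib mult_ac)
  qed
  also have "\<dots> = 2 * (g\<^sup>2 + 2 * real r * h\<^sup>2) ^ r"
    by (subst add.commute) (simp only: binomial_ring sum_distrib_left)
  finally show ?thesis .
qed

section \<open>Minkowski's inequality\<close>

lemma convex_on_power_nonneg: "convex_on {0::real..} (\<lambda>x. x ^ n)"
  by (cases "even n") (auto intro: convex_on_subset convex_power_even convex_power_odd)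

text \<open>Convexity of the power at \<open>u + v = p * (u / p) + q * (v / q)\<close>, with weights
  proportional to \<open>G\<close> and \<open>H\<close>.\<close>

lemma power_add_le_weighted:
  fixes u v G H :: real
  assumes "u \<ge> 0" "v \<ge> 0" "G > 0" "H > 0"
  shows "(u + v) ^ Suc r \<le> (G + H) ^ r * (u ^ Suc r / G ^ r + v ^ Suc r / H ^ r)"
proof -
  define p where "p = G / (G + H)"
  define q where "q = H / (G + H)"
  have pq: "p > 0" "q > 0" "p + q = 1"
    using assms by (auto simp: p_def q_def add_divide_distrib[symmetric])
  have p_eq: "1 - q = p" using pq by simp
  have "(p *\<^sub>R (u / p) + q *\<^sub>R (v / q)) ^ Suc r \<le> p * (u / p) ^ Suc r + q * (v / q) ^ Suc r"
    using convex_onD[OF convex_on_power_nonneg[of "Suc r"], of q "u / p" "v / q"] pq assms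
    by (simp only: p_eq) simp
  moreover have "x / K * (y / (x / K)) ^ Suc r = K ^ r * (y ^ Suc r / x ^ r)" if "x > 0" "K > 0" for x y K :: real
    using that by (simp add: power_divide power_mult_distrib)
  then have "p * (u / p) ^ Suc r = (G + H) ^ r * (u ^ Suc r / G ^ r)"
      "q * (v / q) ^ Suc r = (G + H) ^ r * (v ^ Suc r / H ^ r)"
    using assms unfolding p_def q_def by simp_all
  ultimately show ?thesis using pq by (simp add: distrib_left)
qed

text \<open>Minkowski's inequality without roots: up to the common factor \<open>C\<close> to the
  power \<open>1 / r\<close>, \<open>G\<close> and \<open>H\<close> bound the norms of
  \<open>u\<close> and \<open>v\<close>. With these bounds as weights, the pointwise convexity
  estimate sums to exactly the claim.\<close>

lemma sum_power_minkowski: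
  fixes u v :: "'a \<Rightarrow> real"
  assumes "finite S" and u: "\<And>x. x \<in> S \<Longrightarrow> u x \<ge> 0" and v: "\<And>x. x \<in> S \<Longrightarrow> v x \<ge> 0"
    and "r \<ge> 1" "G \<ge> 0" "H \<ge> 0"
    and uG: "(\<Sum>x\<in>S. u x ^ r) \<le> C * G ^ r" and vH: "(\<Sum>x\<in>S. v x ^ r) \<le> C * H ^ r"
  shows "(\<Sum>x\<in>S. (u x + v x) ^ r) \<le> C * (G + H) ^ r"
proof -
  \<comment> \<open>A zero bound forces the function to vanish on \<open>S\<close>; this settles the
    cases where the weighted estimate would divide by zero.\<close>
  have null: "w x = 0" if "(\<Sum>x\<in>S. w x ^ r) \<le> C * 0 ^ r" "\<And>x. x \<in> S \<Longrightarrow> w x \<ge> 0" "x \<in> S"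
    for w :: "'a \<Rightarrow> real" and x
  proof -
    have "(\<Sum>x\<in>S. w x ^ r) = 0"
      using that \<open>r \<ge> 1\<close> by (intro antisym sum_nonneg) (auto simp: power_0_left)
    then show ?thesis
      using that \<open>finite S\<close> by (subst (asm) sum_nonneg_eq_0_iff) auto
  qed
  consider "G = 0" | "H = 0" | "G > 0" "H > 0" using assms by linarith
  then show ?thesis
  proof cases
    case 1
    then have "u x = 0" if "x \<in> S" for x using null[of u x] uG u that by simp
    then show ?thesis using vH 1 by simp
  next
    case 2
    then have "v x = 0" if "x \<in> S" for x using null[of v x] vH v that by simp
    then show ?thesis using uG 2 by simp
  next
    case 3
    obtain q where q: "r = Suc q" using \<open>r \<ge> 1\<close> by (cases r) auto
    have "(\<Sum>x\<in>S. (u x + v x) ^ r) \<le> (\<Sum>x\<in>S. (G + H) ^ q * (u x ^ r / G ^ q + v x ^ r / H ^ q))"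
      unfolding q using u v 3 by (intro sum_mono power_add_le_weighted) auto
    also have "\<dots> = (G + H) ^ q * ((\<Sum>x\<in>S. u x ^ r) / G ^ q + (\<Sum>x\<in>S. v x ^ r) / H ^ q)"
      by (simp only: sum_distrib_left[symmetric] sum.distrib sum_divide_distrib)
    also have "\<dots> \<le> (G + H) ^ q * (C * G ^ r / G ^ q + C * H ^ r / H ^ q)"
      using 3 uG vH by (intro mult_left_mono add_mono divide_right_mono) auto
    also have "\<dots> = C * (G + H) ^ r"
      using 3 by (simp add: q algebra_simps)
    finally show ?thesis .
  qed
qed

section \<open>Walsh functions on the cube and their even moments\<close>

definition walsh :: "'a set \<Rightarrow> 'a set \<Rightarrow> real" where
  "walsh T Z = (-1) ^ card (T \<inter> Z)"

lemma sum_Pow_insert: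
  fixes f :: "'a set \<Rightarrow> real"
  assumes "finite R" "a \<notin> R"
  shows "(\<Sum>Z\<in>Pow (insert a R). f Z) = (\<Sum>Z\<in>Pow R. f Z + f (insert a Z))"
proof -
  have "inj_on (insert a) (Pow R)" using assms by (auto simp: inj_on_def)
  moreover have "Pow R \<inter> insert a ` Pow R = {}" using assms by auto
  ultimately show ?thesis
    using assms by (simp add: Pow_insert sum.union_disjoint sum.reindex sum.distrib)
qed

text \<open>Bonami's induction over the coordinates. Fixing all but \<open>a\<close> leaves the
  values \<open>g Z + h Z\<close> and \<open>g Z - h Z\<close>; the two-point inequality turns them
  into a sum of squares, and Minkowski's inequality separates \<open>g\<close> from
  \<open>h\<close>, both Walsh polynomials on \<open>R\<close>. The factor \<open>2 * r\<close>
  picked up by \<open>h\<close> accounts for the larger cardinality of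
  \<open>insert a T\<close>.\<close>

lemma walsh_moment_bound:
  fixes c :: "'a set \<Rightarrow> real"
  assumes "finite R" "r \<ge> 1"
  shows "(\<Sum>Z\<in>Pow R. (\<Sum>T\<in>Pow R. c T * walsh T Z) ^ (2 * r)) \<le>
         2 ^ card R * (\<Sum>T\<in>Pow R. (2 * real r) ^ card T * (c T)\<^sup>2) ^ r"
  using assms(1)
proof (induction R arbitrary: c rule: finite_induct)
  case empty
  then show ?case by (simp add: walsh_def power_mult)
next
  case (insert a R)
  define g where "g Z = (\<Sum>T\<in>Pow R. c T * walsh T Z)" for Z
  define h where "h Z = (\<Sum>T\<in>Pow R. c (insert a T) * walsh T Z)" for Z
  define G where "G = (\<Sum>T\<in>Pow R. (2 * real r) ^ card T * (c T)\<^sup>2)"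
  define H where "H = (\<Sum>T\<in>Pow R. (2 * real r) ^ card T * (c (insert a T))\<^sup>2)"
  have w: "walsh T (insert a Z) = walsh T Z" "walsh (insert a T) Z = walsh T Z"
       "walsh (insert a T) (insert a Z) = - walsh T Z" if "Z \<subseteq> R" "T \<subseteq> R" for T Z
  proof -
    have "a \<notin> T" "a \<notin> Z" "finite T" using that insert by (auto intro: finite_subset)
    then show "walsh T (insert a Z) = walsh T Z" "walsh (insert a T) Z = walsh T Z"
       "walsh (insert a T) (insert a Z) = - walsh T Z" by (auto simp: walsh_def)
  qed
  have "(\<Sum>Z\<in>Pow (insert a R). (\<Sum>T\<in>Pow (insert a R). c T * walsh T Z) ^ (2 * r)) =
        (\<Sum>Z\<in>Pow R. (g Z + h Z) ^ (2 * r) + (g Z - h Z) ^ (2 * r))"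
    unfolding sum_Pow_insert[OF insert(1,2)]
    by (intro sum.cong refl) (simp add: g_def h_def w sum.distrib sum_subtractf)
  also have "\<dots> \<le> (\<Sum>Z\<in>Pow R. 2 * ((g Z)\<^sup>2 + 2 * real r * (h Z)\<^sup>2) ^ r)"
    by (intro sum_mono sum_power_two_point)
  also have "\<dots> = 2 * (\<Sum>Z\<in>Pow R. ((g Z)\<^sup>2 + 2 * real r * (h Z)\<^sup>2) ^ r)"
    by (simp add: sum_distrib_left)
  also have "(\<Sum>Z\<in>Pow R. ((g Z)\<^sup>2 + 2 * real r * (h Z)\<^sup>2) ^ r) \<le> 2 ^ card R * (G + 2 * real r * H) ^ r"
  proof (rule sum_power_minkowski)
    show "(\<Sum>Z\<in>Pow R. (g Z)\<^sup>2 ^ r) \<le> 2 ^ card R * G ^ r"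
      using insert.IH[of c] by (simp add: g_def G_def power_mult)
    have "(\<Sum>Z\<in>Pow R. (2 * real r * (h Z)\<^sup>2) ^ r) = (2 * real r) ^ r * (\<Sum>Z\<in>Pow R. h Z ^ (2 * r))"
      by (simp add: power_mult_distrib sum_distrib_left power_mult)
    also have "\<dots> \<le> (2 * real r) ^ r * (2 ^ card R * H ^ r)"
      using insert.IH[of "\<lambda>T. c (insert a T)"] unfolding h_def H_def by (intro mult_left_mono) auto
    finally show "(\<Sum>Z\<in>Pow R. (2 * real r * (h Z)\<^sup>2) ^ r) \<le> 2 ^ card R * (2 * real r * H) ^ r"
      by (simp add: power_mult_distrib algebra_simps)
  qed (use insert.hyps assms(2) in \<open>auto simp: G_def H_def intro!: sum_nonneg mult_nonneg_nonneg\<close>)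
  also have "2 * (2 ^ card R * (G + 2 * real r * H) ^ r) = 2 ^ card (insert a R) *
      (\<Sum>T\<in>Pow (insert a R). (2 * real r) ^ card T * (c T)\<^sup>2) ^ r"
  proof -
    have "(\<Sum>T\<in>Pow (insert a R). (2 * real r) ^ card T * (c T)\<^sup>2) = G + 2 * real r * H"
    proof -
      have "card (insert a T) = Suc (card T)" if "T \<in> Pow R" for T
        using that insert.hyps by (subst card_insert_disjoint) (auto intro: finite_subset)
      then show ?thesis unfolding sum_Pow_insert[OF insert(1,2)]
        by (simp add: G_def H_def sum.distrib sum_distrib_left mult.assoc)
    qed
    then show ?thesis using insert.hyps by simp
  qed
  finally show ?case by simp
qed

text \<open>Jensen's inequality for the convex even power, with uniform weights on
  \<open>S\<close>.\<close>

lemma sum_power_even_le: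
  fixes f :: "'a \<Rightarrow> real"
  assumes "finite S" "r \<ge> 1"
  shows "(\<Sum>x\<in>S. f x) ^ (2 * r) \<le> real (card S) ^ (2 * r - 1) * (\<Sum>x\<in>S. f x ^ (2 * r))"
proof (cases "S = {}")
  case False
  define C where "C = real (card S)"
  have C: "C > 0" using False assms by (simp add: C_def card_gt_0_iff)
  have pw: "C ^ (2 * r) = C * C ^ (2 * r - 1)"
    using \<open>r \<ge> 1\<close> by (simp add: power_eq_if)
  have "(\<Sum>x\<in>S. (1 / C) *\<^sub>R f x) ^ (2 * r) \<le> (\<Sum>x\<in>S. (1 / C) * f x ^ (2 * r))"
    using assms False C by (intro convex_on_sum[OF _ _ convex_power_even]) (auto simp: C_def)
  then have "(\<Sum>x\<in>S. f x) ^ (2 * r) / C ^ (2 * r) \<le> (\<Sum>x\<in>S. f x ^ (2 * r)) / C"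
    by (simp add: sum_divide_distrib[symmetric] power_divide)
  then show ?thesis unfolding C_def[symmetric] pw using C
    by (simp add: field_simps)
qed (use assms in \<open>auto simp: power_0_left\<close>)

text \<open>The best guess of a random parity from the message \<open>\<mu> Z\<close> is a Walsh polynomial depending on
  the message. Jensen's inequality passes to its \<open>2r\<close>-th moment, where the union over all messages
  costs only the \<open>2r\<close>-th root of their number.\<close>

lemma walsh_correlation_bound:
  fixes k :: nat and \<mu> :: "'a set \<Rightarrow> 'b" and D :: "'b \<Rightarrow> 'a set \<Rightarrow> real"
  assumes "finite R" "r \<ge> 1" and \<mu>: "\<And>Z. Z \<subseteq> R \<Longrightarrow> \<mu> Z \<in> L" "finite L"
    and D: "\<And>b T. \<bar>D b T\<bar> \<le> 1"
  defines "\<T> \<equiv> {T. T \<subseteq> R \<and> card T = k}"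
  shows "(\<Sum>Z\<in>Pow R. \<Sum>T\<in>\<T>. walsh T Z * D (\<mu> Z) T) ^ (2 * r) \<le>
         real (card L) * (2 ^ card R) ^ (2 * r) * ((2 * real r) ^ k * real (card R choose k)) ^ r"
proof -
  \<comment> \<open>Zero coefficients outside cardinality \<open>k\<close> make the polynomial of
    each message homogeneous of degree \<open>k\<close>.\<close>
  define c where "c b T = (if card T = k then D b T else 0)" for b T
  define g where "g b Z = (\<Sum>T\<in>Pow R. c b T * walsh T Z)" for b Z
  have fin: "finite (Pow R)" using assms by simp
  have g: "(\<Sum>T\<in>\<T>. walsh T Z * D b T) = g b Z" for b Z
    unfolding g_def c_def \<T>_def using fin
    by (intro sum.mono_neutral_cong_left) auto
  have mom: "(\<Sum>Z\<in>Pow R. g b Z ^ (2 * r)) \<le> 2 ^ card R * ((2 * real r) ^ k * real (card R choose k)) ^ r" for b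
  proof -
    have "(\<Sum>Z\<in>Pow R. g b Z ^ (2 * r)) \<le> 2 ^ card R * (\<Sum>T\<in>Pow R. (2 * real r) ^ card T * (c b T)\<^sup>2) ^ r"
      unfolding g_def using assms by (intro walsh_moment_bound)
    also have "(\<Sum>T\<in>Pow R. (2 * real r) ^ card T * (c b T)\<^sup>2) = (\<Sum>T\<in>\<T>. (2 * real r) ^ k * (D b T)\<^sup>2)"
      unfolding c_def \<T>_def using fin by (intro sum.mono_neutral_cong_right) auto
    also have "\<dots> ^ r \<le> (\<Sum>T\<in>\<T>. (2 * real r) ^ k) ^ r"
      using D by (intro power_mono sum_mono mult_left_le sum_nonneg) (auto simp: abs_square_le_1)
    also have "(\<Sum>T\<in>\<T>. (2 * real r) ^ k) = (2 * real r) ^ k * real (card R choose k)"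
      using assms by (simp add: n_subsets)
    finally show ?thesis
      by simp
  qed
  have "(\<Sum>Z\<in>Pow R. \<Sum>T\<in>\<T>. walsh T Z * D (\<mu> Z) T) ^ (2 * r) = (\<Sum>Z\<in>Pow R. g (\<mu> Z) Z) ^ (2 * r)"
    by (simp add: g)
  also have "\<dots> \<le> real (card (Pow R)) ^ (2 * r - 1) * (\<Sum>Z\<in>Pow R. g (\<mu> Z) Z ^ (2 * r))"
    using fin assms(2) by (rule sum_power_even_le)
  \<comment> \<open>Even powers are nonnegative, so the term of the message \<open>\<mu> Z\<close>
    is at most the sum over all of \<open>L\<close>; then the moment bound applies to each fixed
    message.\<close>
  also have "\<dots> \<le> real (card (Pow R)) ^ (2 * r - 1) * (\<Sum>Z\<in>Pow R. \<Sum>b\<in>L. g b Z ^ (2 * r))"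
    using \<mu> by (intro mult_left_mono sum_mono member_le_sum) auto
  also have "\<dots> = real (card (Pow R)) ^ (2 * r - 1) * (\<Sum>b\<in>L. \<Sum>Z\<in>Pow R. g b Z ^ (2 * r))"
    by (subst sum.swap) simp
  also have "\<dots> \<le> real (card (Pow R)) ^ (2 * r - 1) *
      (\<Sum>b\<in>L. 2 ^ card R * ((2 * real r) ^ k * real (card R choose k)) ^ r)"
    by (intro mult_left_mono sum_mono mom) auto
  also have "\<dots> = real (card L) * (2 ^ card R * (2 ^ card R) ^ (2 * r - 1)) * ((2 * real r) ^ k * real (card R choose k)) ^ r"
    using assms(1) by (simp add: card_Pow)
  also have "2 ^ card R * (2 ^ card R) ^ (2 * r - 1) = ((2::real) ^ card R) ^ (2 * r)"
    using \<open>r \<ge> 1\<close> by (simp add: power_eq_if)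
  finally show ?thesis .
qed

section \<open>Messages of bounded length\<close>

lemma finite_card_bool_lists_le:
  "finite {l :: bool list. length l \<le> s}" "card {l :: bool list. length l \<le> s} \<le> 2 ^ (s + 1)"
proof -
  have "finite {l :: bool list. set l \<subseteq> UNIV \<and> length l \<le> s}"
    by (rule finite_lists_length_le) simp
  then show "finite {l :: bool list. length l \<le> s}" by simp
  have "card {l :: bool list. set l \<subseteq> UNIV \<and> length l \<le> s} = (\<Sum>i\<le>s. card (UNIV :: bool set) ^ i)"
    by (rule card_lists_length_le) simp
  also have "\<dots> \<le> 2 ^ (s + 1)"
    by (induction s) auto
  finally show "card {l :: bool list. length l \<le> s} \<le> 2 ^ (s + 1)" by simp
qed

text \<open>Toggling one element of \<open>T\<close> in \<open>Z\<close> changes the sign, so the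
  terms cancel in pairs.\<close>

lemma sum_walsh_eq_0:
  assumes "finite R" "T \<subseteq> R" "T \<noteq> {}"
  shows "(\<Sum>Z\<in>Pow R. walsh T Z) = 0"
proof -
  obtain a where a: "a \<in> T" using assms by blast
  have "(\<Sum>Z\<in>Pow (insert a (R - {a})). walsh T Z) = (\<Sum>Z\<in>Pow (R - {a}). walsh T Z + walsh T (insert a Z))"
    using assms by (intro sum_Pow_insert) auto
  also have "\<dots> = 0"
  proof (intro sum.neutral ballI)
    fix Z assume "Z \<in> Pow (R - {a})"
    then have "a \<notin> T \<inter> Z" "T \<inter> insert a Z = insert a (T \<inter> Z)" using a by auto
    moreover have "finite (T \<inter> Z)" using assms by (auto intro: finite_subset)
    ultimately show "walsh T Z + walsh T (insert a Z) = 0"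
      by (simp only: walsh_def card_insert_disjoint) simp
  qed
  finally show ?thesis using a assms(2) by (simp add: insert_absorb subsetD)
qed

text \<open>The moment has order \<open>2 * s\<close>, so that the at most \<open>4 ^ s\<close>
  messages cost only a factor 2 after taking the root.\<close>

lemma walsh_correlation_bound_bits:
  fixes \<mu> :: "'a set \<Rightarrow> bool list" and D :: "bool list \<Rightarrow> 'a set \<Rightarrow> real"
  assumes "finite R" "t \<ge> 1" "2 * t \<le> card R"
    and \<mu>: "\<And>Z. Z \<subseteq> R \<Longrightarrow> length (\<mu> Z) \<le> s"
    and D: "\<And>b T. \<bar>D b T\<bar> \<le> 1"
  shows "(\<Sum>Z\<in>Pow R. \<Sum>T | T \<subseteq> R \<and> card T = 2 * t. walsh T Z * D (\<mu> Z) T) \<le>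
         2 ^ card R * real (card R choose (2 * t)) * (2 * (4 * real t * real s / real (card R)) ^ t)"
    (is "?S \<le> _")
\<comment> \<open>For \<open>s = 0\<close> no moment of positive order is available; there the only
  message is \<open>[]\<close>, and a guess independent of \<open>Z\<close> has no correlation with
  the parity.\<close>
proof (cases "s = 0")
  case True
  have "?S = (\<Sum>T | T \<subseteq> R \<and> card T = 2 * t. \<Sum>Z\<in>Pow R. walsh T Z * D [] T)"
    by (subst sum.swap) (use \<mu> True in \<open>auto intro!: sum.cong\<close>)
  also have "\<dots> = 0"
  proof (rule sum.neutral, rule ballI)
    fix T assume "T \<in> {T. T \<subseteq> R \<and> card T = 2 * t}"
    then have "T \<subseteq> R" "T \<noteq> {}" using \<open>t \<ge> 1\<close> by auto
    then show "(\<Sum>Z\<in>Pow R. walsh T Z * D [] T) = 0"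
      using sum_walsh_eq_0[OF assms(1)] by (simp flip: sum_distrib_right)
  qed
  finally show ?thesis using True \<open>t \<ge> 1\<close> by (simp add: power_0_left)
next
  case False
  then have "s \<ge> 1" by simp
  define B where "B = real (card R choose (2 * t))"
  define N where "N = real (card R)"
  have N: "N > 0" using assms by (simp add: N_def)
  have B: "B > 0" using assms by (simp add: B_def)
  have "?S ^ (2 * s) \<le> real (card {l :: bool list. length l \<le> s}) * (2 ^ card R) ^ (2 * s) *
      ((2 * real s) ^ (2 * t) * B) ^ s"
    unfolding B_def using assms \<open>s \<ge> 1\<close> finite_card_bool_lists_le(1) by (intro walsh_correlation_bound) auto
  also have "real (card {l :: bool list. length l \<le> s}) \<le> 4 ^ s"
  proof -
    have "card {l :: bool list. length l \<le> s} \<le> 2 ^ (2 * s)"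
      using finite_card_bool_lists_le(2)[of s] power_increasing[of "s + 1" "2 * s" "2 :: nat"] \<open>s \<ge> 1\<close>
      by linarith
    then have "real (card {l :: bool list. length l \<le> s}) \<le> real (2 ^ (2 * s))"
      by (simp only: of_nat_le_iff)
    then show ?thesis by (simp add: power_mult)
  qed
  finally have "?S ^ (2 * s) \<le> 4 ^ s * (2 ^ card R) ^ (2 * s) * ((2 * real s) ^ (2 * t) * B) ^ s"
    using B by (simp add: mult_right_mono)
  then have "(?S\<^sup>2) ^ s \<le> (4 * (2 ^ card R)\<^sup>2 * ((2 * real s) ^ (2 * t) * B)) ^ s"
    by (simp add: power_mult power_mult_distrib)
  then have "?S\<^sup>2 \<le> 4 * (2 ^ card R)\<^sup>2 * ((2 * real s) ^ (2 * t) * B)"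
    using \<open>s \<ge> 1\<close> B by (subst (asm) power_mono_iff) auto
  \<comment> \<open>The factor \<open>B * (2 * t / N) ^ (2 * t)\<close>, which is at least 1, is
    inserted to make the right side a square.\<close>
  also have "\<dots> \<le> 4 * (2 ^ card R)\<^sup>2 * ((2 * real s) ^ (2 * t) * (B * (B * (2 * real t / N) ^ (2 * t))))"
  proof -
    have "(N / (2 * real t)) ^ (2 * t) \<le> B"
      using binomial_ge_n_over_k_pow_k[of "2 * t" "card R", where 'a = real] assms by (simp add: B_def N_def)
    then have "1 \<le> B * (2 * real t / N) ^ (2 * t)"
      using N \<open>t \<ge> 1\<close> by (simp add: power_divide field_simps)
    then show ?thesis using B by (intro mult_left_mono) auto
  qed
  also have "\<dots> = (2 ^ card R * B * (2 * (4 * real t * real s / N) ^ t))\<^sup>2"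
  proof -
    have "(4::real) ^ t = 2 ^ t * 2 ^ t" by (simp flip: power_mult_distrib)
    then show ?thesis
      by (simp add: power_mult_distrib power_divide power_mult power2_eq_square mult_ac)
  qed
  finally show ?thesis
    unfolding B_def N_def by (rule power2_le_imp_le) (auto intro!: mult_nonneg_nonneg)
qed

text \<open>Each edge of \<open>F\<close> can merge at most two of the label classes.\<close>

lemma connected_graph_card_labels:
  fixes lab :: "nat \<Rightarrow> nat"
  assumes "finite F" "finite V" "connected_graph V E"
    and "\<And>x y. {x, y} \<in> E - F \<Longrightarrow> lab x = lab y"
  shows "card (lab ` V) \<le> card F + 1"
  using assms(1,4)
proof (induction F arbitrary: lab rule: finite_induct)
  case empty
  have "lab u = lab v" if "u \<in> V" "v \<in> V" for u v
  proof -
    have "(u, v) \<in> {(x, y). {x, y} \<in> E}\<^sup>*"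
      using that assms(3) by (simp add: connected_graph_def)
    then show ?thesis
    proof (induction rule: rtrancl_induct)
      case (step y z)
      have "{y, z} \<in> E - {}" using step.hyps(2) by blast
      then have "lab y = lab z" by (rule empty.prems)
      with step.IH show ?case by (rule trans)
    qed simp
  qed
  then have "\<forall>x\<in>lab ` V. \<forall>y\<in>lab ` V. x = y" by blast
  then have "card (lab ` V) \<le> Suc 0"
    by (rule iffD2[OF card_le_Suc0_iff_eq[OF finite_imageI[OF \<open>finite V\<close>]]])
  then show ?case by simp
next
  case (insert f F)
  show ?case
  proof (cases "\<exists>a b. f = {a, b}")
    case True
    then obtain a b where f: "f = {a, b}" by blast
    \<comment> \<open>The class of \<open>b\<close> is merged into that of \<open>a\<close>: the new
      labels agree on the ends of \<open>f\<close>, and at most the value \<open>lab b\<close> is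
      lost.\<close>
    define lab' where "lab' v = (if lab v = lab b then lab a else lab v)" for v
    have "lab' x = lab' y" if "{x, y} \<in> E - F" for x y
    proof (cases "{x, y} = f")
      case True
      then show ?thesis by (auto simp: f lab'_def doubleton_eq_iff)
    next
      case False
      then show ?thesis using insert.prems[of x y] that by (simp add: lab'_def)
    qed
    then have "card (lab' ` V) \<le> card F + 1" by (rule insert.IH)
    moreover have "lab ` V \<subseteq> insert (lab b) (lab' ` V)"
      by (force simp: lab'_def)
    then have "card (lab ` V) \<le> card (insert (lab b) (lab' ` V))"
      using \<open>finite V\<close> by (intro card_mono) auto
    then have "card (lab ` V) \<le> Suc (card (lab' ` V))"
      using \<open>finite V\<close> by (simp add: card_insert_if split: if_splits)
    ultimately show ?thesis using insert.hyps by simp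
  next
    \<comment> \<open>No \<open>{x, y}\<close> equals such an \<open>f\<close>, so the labels
      already agree on every pair in \<open>E - F\<close>.\<close>
    case False
    have "card (lab ` V) \<le> card F + 1"
    proof (rule insert.IH)
      fix x y assume "{x, y} \<in> E - F"
      with False have "{x, y} \<in> E - insert f F" by blast
      then show "lab x = lab y" by (rule insert.prems)
    qed
    then show ?thesis using insert.hyps by simp
  qed
qed

section \<open>The hard graphs\<close>

text \<open>Coordinate \<open>i < q\<close> owns the vertices \<open>4 i, \<dots>, 4 i + 3\<close>, and \<open>4 q\<close> is the root. A bit of \<open>X\<close> decides
  whether \<open>{4 i, 4 i + 1}\<close> is matched to \<open>{4 i + 2, 4 i + 3}\<close> straight or crosswise. Chaining the
  coordinates of a set \<open>T\<close> gives two disjoint paths whose ends are interchanged according to the parity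
  of \<open>X \<inter> T\<close>. The start of one path is joined to the root, and a query bit selects which of
  the two end vertices is joined to the root as well.\<close>

definition bit_edge :: "nat set \<Rightarrow> nat \<times> bool \<Rightarrow> edge" where
  "bit_edge X = (\<lambda>(i, c). {4 * i + of_bool c, 4 * i + 2 + of_bool (c \<noteq> (i \<in> X))})"

definition bit_stream :: "nat \<Rightarrow> nat set \<Rightarrow> edge list" where
  "bit_stream q X = map (bit_edge X) (List.product [0..<q] [False, True])"

definition next_in :: "nat set \<Rightarrow> nat \<Rightarrow> nat" where
  "next_in T i = Min {j \<in> T. i < j}"

definition chain_edges :: "nat set \<Rightarrow> edge set" where
  "chain_edges T = (\<lambda>(i, c). {4 * i + 2 + of_bool c, 4 * next_in T i + of_bool c}) ` ((T - {Max T}) \<times> UNIV)"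

text \<open>The last union attaches every vertex of a block outside all sets to the root, including
  the rest of the root's own block, so that paths missing the root are the only possible extra
  components.\<close>

definition query_edges :: "nat \<Rightarrow> nat \<Rightarrow> (nat \<Rightarrow> nat set) \<Rightarrow> (nat \<Rightarrow> bool) \<Rightarrow> edge set" where
  "query_edges q m e w =
     (\<Union>j<m. chain_edges (e j) \<union> {{4 * Min (e j), 4 * q}, {4 * Max (e j) + 2 + of_bool (w j), 4 * q}}) \<union>
     (\<lambda>v. {v, 4 * q}) ` {v. v < 4 * (q + 1) \<and> v \<noteq> 4 * q \<and> v div 4 \<notin> (\<Union>j<m. e j)}"

text \<open>The value \<open>{}\<close> from index \<open>m\<close> on leaves finitely many
  functions, so uniform averages are sums.\<close>

definition disjoint_families :: "nat \<Rightarrow> nat \<Rightarrow> nat \<Rightarrow> (nat \<Rightarrow> nat set) set" where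
  "disjoint_families q m k = {e. (\<forall>j<m. e j \<subseteq> {..<q} \<and> card (e j) = k) \<and> (\<forall>j\<ge>m. e j = {}) \<and>
     (\<forall>i<m. \<forall>j<m. i \<noteq> j \<longrightarrow> e i \<inter> e j = {})}"

text \<open>The parity of the crossings before block \<open>i\<close>; for \<open>i \<in> T\<close>
  it is the offset at which the path from \<open>4 * Min T\<close> enters that block.\<close>

definition prefix_parity :: "nat set \<Rightarrow> nat set \<Rightarrow> nat \<Rightarrow> bool" where
  "prefix_parity X T i = odd (card {x \<in> X \<inter> T. x < i})"

text \<open>The far path starts at \<open>4 * Min T + 1\<close>. On the left pair of a block only
  earlier crossings count, on the right pair also the one inside the block.\<close>

definition on_far_path :: "nat set \<Rightarrow> nat set \<Rightarrow> nat \<Rightarrow> bool" where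
  "on_far_path X T v \<longleftrightarrow> (if v mod 4 < 2 then (v mod 4 = 1) \<noteq> prefix_parity X T (v div 4)
     else (v mod 4 = 3) \<noteq> prefix_parity X T (Suc (v div 4)))"

text \<open>For a disjoint family at most one summand is nonzero: the far path of the
  \<open>j\<close>-th set gets \<open>Suc j\<close>, and all else shares 0 with the root.\<close>

definition component_label :: "nat \<Rightarrow> (nat \<Rightarrow> nat set) \<Rightarrow> nat set \<Rightarrow> nat \<Rightarrow> nat" where
  "component_label m e X v = (\<Sum>j<m. if v div 4 \<in> e j \<and> on_far_path X (e j) v then Suc j else 0)"

section \<open>Blocks of four vertices and parities along a chain\<close>

lemma block_arith [simp]:
  "(4 * i + of_bool c) div 4 = (i::nat)" "(4 * i + 2 + of_bool c) div 4 = (i::nat)"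
  "(4 * i + of_bool c) mod 4 = (of_bool c :: nat)" "(4 * i + 2 + of_bool c) mod 4 = (2 + of_bool c :: nat)"
  "Suc (Suc (4 * i + of_bool c)) div 4 = (i::nat)" "Suc (Suc (4 * i + of_bool c)) mod 4 = (2 + of_bool c :: nat)"
  by (cases c; simp; presburger)+

lemma vertex_cases:
  fixes v :: nat
  obtains c where "v = 4 * (v div 4) + of_bool c" | c where "v = 4 * (v div 4) + 2 + of_bool c"
proof -
  have v: "v = 4 * (v div 4) + v mod 4" by simp
  consider "v mod 4 = 0" | "v mod 4 = 1" | "v mod 4 = 2" | "v mod 4 = 3" by linarith
  then show thesis
  proof cases
    case 1
    then show thesis using v that(1)[of False] by simp
  next
    case 2
    then show thesis using v that(1)[of True] by simp
  next
    case 3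
    then show thesis using v that(2)[of False] by simp
  next
    case 4
    then show thesis using v that(2)[of True] by simp
  qed
qed

lemma next_in:
  assumes "finite T" "i \<in> T" "i \<noteq> Max T"
  shows "next_in T i \<in> T" "i < next_in T i" "\<And>x. x \<in> T \<Longrightarrow> x < next_in T i \<longleftrightarrow> x \<le> i"
proof -
  let ?S = "{j \<in> T. i < j}"
  have "Max T \<in> ?S" using assms by simp (metis Max_ge Max_in assms(1) empty_iff le_neq_implies_less)
  then have S: "finite ?S" "?S \<noteq> {}" using assms by auto
  have "next_in T i \<in> ?S" unfolding next_in_def using S by (rule Min_in)
  then show *: "next_in T i \<in> T" "i < next_in T i" by auto
  fix x assume "x \<in> T"
  show "x < next_in T i \<longleftrightarrow> x \<le> i"
  proof
    assume "x < next_in T i"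
    then show "x \<le> i" using S \<open>x \<in> T\<close> unfolding next_in_def by (metis (mono_tags, lifting) Min_le leD mem_Collect_eq not_le)
  qed (use * in auto)
qed

text \<open>The predecessor is the largest element of \<open>T\<close> below \<open>i\<close>; it
  allows walking a path back to its start.\<close>

lemma next_in_surj:
  assumes "finite T" "i \<in> T" "i \<noteq> Min T"
  obtains p where "p \<in> T" "p \<noteq> Max T" "p < i" "next_in T p = i"
proof -
  let ?S = "{j \<in> T. j < i}"
  have "Min T \<in> ?S" using assms by (metis (mono_tags, lifting) Min_in Min_le empty_iff le_neq_implies_less mem_Collect_eq)
  then have S: "finite ?S" "?S \<noteq> {}" using assms by auto
  define p where "p = Max ?S"
  have p: "p \<in> T" "p < i" using Max_in[OF S] by (auto simp: p_def)
  have "p \<noteq> Max T" using p assms by (metis Max_ge leD)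
  moreover have "next_in T p = i"
  proof -
    note n = next_in[OF assms(1) p(1) \<open>p \<noteq> Max T\<close>]
    have "next_in T p \<le> i" using n(3)[OF assms(2)] p by auto
    moreover have "\<not> next_in T p < i"
    proof
      assume "next_in T p < i"
      then have "next_in T p \<le> p" unfolding p_def using S n(1)[unfolded p_def] by (intro Max_ge) (auto simp: p_def)
      then show False using n(2) by simp
    qed
    ultimately show ?thesis by simp
  qed
  ultimately show thesis using p that by blast
qed

lemma prefix_parity_Suc:
  assumes "i \<in> T"
  shows "prefix_parity X T (Suc i) \<longleftrightarrow> prefix_parity X T i \<noteq> (i \<in> X)"
proof -
  have "finite {x \<in> X \<inter> T. x < i}" by simp
  moreover have "{x \<in> X \<inter> T. x < Suc i} = (if i \<in> X then insert i {x \<in> X \<inter> T. x < i} else {x \<in> X \<inter> T. x < i})"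
    using assms by (auto simp: less_Suc_eq)
  ultimately show ?thesis by (simp add: prefix_parity_def)
qed

text \<open>No element of \<open>T\<close> lies strictly between \<open>i\<close> and its
  successor.\<close>

lemma prefix_parity_next_in:
  assumes "finite T" "i \<in> T" "i \<noteq> Max T"
  shows "prefix_parity X T (next_in T i) = prefix_parity X T (Suc i)"
proof -
  have "{x \<in> X \<inter> T. x < next_in T i} = {x \<in> X \<inter> T. x < Suc i}"
    using next_in(3)[OF assms] by (auto simp: less_Suc_eq_le)
  then show ?thesis by (simp add: prefix_parity_def)
qed

lemma prefix_parity_Min: "finite T \<Longrightarrow> \<not> prefix_parity X T (Min T)"
proof -
  assume "finite T"
  then have "{x \<in> X \<inter> T. x < Min T} = {}" by (auto simp: not_less)
  then show ?thesis by (simp only: prefix_parity_def) simp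
qed

lemma prefix_parity_Max: "finite T \<Longrightarrow> prefix_parity X T (Suc (Max T)) = odd (card (X \<inter> T))"
proof -
  assume "finite T"
  then have "{x \<in> X \<inter> T. x < Suc (Max T)} = X \<inter> T" by (auto simp: less_Suc_eq_le)
  then show ?thesis by (simp only: prefix_parity_def)
qed

section \<open>The edges that encode \<open>X\<close>\<close>

lemma length_bit_stream: "length (bit_stream q X) = 2 * q"
  by (simp add: bit_stream_def)

text \<open>The smaller vertex of an edge is \<open>4 * i + of_bool c\<close>, and it determines
  \<open>(i, c)\<close>.\<close>

lemma distinct_bit_stream: "distinct (bit_stream q X)"
proof -
  have "inj_on (bit_edge X) A" for A
  proof (rule inj_onI)
    fix x y assume *: "bit_edge X x = bit_edge X y"
    obtain i c j d where xy: "x = (i, c)" "y = (j, d)" by (cases x, cases y)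
    have "4 * i + of_bool c = 4 * j + of_bool d \<or> 4 * i + of_bool c = 4 * j + 2 + of_bool (d \<noteq> (j \<in> X))"
      using * by (auto simp: bit_edge_def xy doubleton_eq_iff)
    moreover have "4 * j + of_bool d = 4 * i + of_bool c \<or> 4 * j + of_bool d = 4 * i + 2 + of_bool (c \<noteq> (i \<in> X))"
      using * by (auto simp: bit_edge_def xy doubleton_eq_iff)
    ultimately have "4 * i + of_bool c = 4 * j + of_bool d"
      by (auto simp: of_bool_def split: if_splits)
    then have "i = j" "c = d"
      by (metis block_arith(1), metis block_arith(3) of_bool_eq_iff)
    then show "x = y" by (simp add: xy)
  qed
  then show ?thesis
    unfolding bit_stream_def distinct_map by (simp add: distinct_product)
qed

lemma set_bit_stream: "set (bit_stream q X) = bit_edge X ` ({..<q} \<times> UNIV)"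
  by (auto simp: bit_stream_def)

lemma simple_graph_bit_stream: "simple_graph {..<4 * (q + 1)} (set (bit_stream q X))"
proof -
  have "\<exists>u v. bit_edge X (i, c) = {u, v} \<and> u < 4 * (q + 1) \<and> v < 4 * (q + 1) \<and> u \<noteq> v" if "i < q" for i c
    by (rule exI[of _ "4 * i + of_bool c"], rule exI[of _ "4 * i + 2 + of_bool (c \<noteq> (i \<in> X))"])
       (use that in \<open>auto simp: bit_edge_def of_bool_def\<close>)
  then show ?thesis
    unfolding simple_graph_def set_bit_stream by auto
qed

section \<open>Connected and far instances for a fixed family of disjoint sets\<close>

context
  fixes q m k :: nat and e :: "nat \<Rightarrow> nat set"
  assumes e: "e \<in> disjoint_families q m k" and k: "k \<ge> 1"
begin

lemma family_props:
  assumes "j < m"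
  shows "finite (e j)" "e j \<noteq> {}" "e j \<subseteq> {..<q}" "card (e j) = k"
  using e k assms by (auto simp: disjoint_families_def intro: finite_subset)

lemma family_disjoint: "i < m \<Longrightarrow> j < m \<Longrightarrow> x \<in> e i \<Longrightarrow> x \<in> e j \<Longrightarrow> i = j"
  using e unfolding disjoint_families_def by blast

lemma card_family_Union: "card (\<Union>j<m. e j) = k * m"
proof -
  have "card (\<Union>j\<in>{..<m}. e j) = (\<Sum>j<m. card (e j))"
    using family_props e by (intro card_UN_disjoint) (auto simp: disjoint_families_def)
  also have "\<dots> = k * m" using family_props by simp
  finally show ?thesis .
qed

lemma query_edge_cases:
  assumes "f \<in> query_edges q m e w"
  obtains (chain) j i c where "j < m" "i \<in> e j" "i \<noteq> Max (e j)"
      "f = {4 * i + 2 + of_bool c, 4 * next_in (e j) i + of_bool c}"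
  | (first) j where "j < m" "f = {4 * Min (e j), 4 * q}"
  | (last) j where "j < m" "f = {4 * Max (e j) + 2 + of_bool (w j), 4 * q}"
  | (star) v where "v < 4 * (q + 1)" "v \<noteq> 4 * q" "v div 4 \<notin> (\<Union>j<m. e j)" "f = {v, 4 * q}"
proof -
  consider j where "j < m" "f \<in> chain_edges (e j)" | j where "j < m" "f = {4 * Min (e j), 4 * q}"
    | j where "j < m" "f = {4 * Max (e j) + 2 + of_bool (w j), 4 * q}"
    | v where "v < 4 * (q + 1)" "v \<noteq> 4 * q" "v div 4 \<notin> (\<Union>j<m. e j)" "f = {v, 4 * q}"
    using assms unfolding query_edges_def by auto
  then show thesis
  proof cases
    case (1 j)
    from 1(2) obtain x where "x \<in> (e j - {Max (e j)}) \<times> (UNIV :: bool set)"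
      "f = (case x of (i, c) \<Rightarrow> {4 * i + 2 + of_bool c, 4 * next_in (e j) i + of_bool c})"
      unfolding chain_edges_def by (rule imageE)
    then show thesis using chain[OF 1(1), of "fst x" "snd x"] by (auto split: prod.splits)
  qed (use first last star in blast)+
qed

text \<open>The last conjunct separates query edges from bit edges, which stay inside one block
  below \<open>q\<close>.\<close>

lemma query_edge_pair:
  assumes "f \<in> query_edges q m e w"
  shows "\<exists>u v. f = {u, v} \<and> u < 4 * (q + 1) \<and> v < 4 * (q + 1) \<and> u \<noteq> v \<and> (u div 4 \<noteq> v div 4 \<or> v div 4 = q)"
  using assms
proof (cases rule: query_edge_cases)
  case (chain j i c)
  note n = next_in[OF family_props(1)[OF chain(1)] chain(2,3)]
  have "i < q" "next_in (e j) i < q" using n chain family_props(3)[OF chain(1)] by auto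
  then have "4 * i + 2 + of_bool c < 4 * (q + 1)" "4 * next_in (e j) i + of_bool c < 4 * (q + 1)"
      "(4 * i + 2 + of_bool c) div 4 \<noteq> (4 * next_in (e j) i + of_bool c) div 4"
    using n(2) unfolding block_arith by (auto simp: of_bool_def)
  then show ?thesis unfolding chain(4) by metis
next
  case (first j)
  then have "Min (e j) < q" using family_props[OF first(1)] Min_in by blast
  then show ?thesis unfolding first(2)
    by (intro exI[of _ "4 * Min (e j)"] exI[of _ "4 * q"]) auto
next
  case (last j)
  then have "Max (e j) < q" using family_props[OF last(1)] Max_in by blast
  then show ?thesis unfolding last(2)
    by (intro exI[of _ "4 * Max (e j) + 2 + of_bool (w j)"] exI[of _ "4 * q"]) (auto simp: of_bool_def)
next
  case (star v)
  then show ?thesis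
    by (intro exI[of _ v] exI[of _ "4 * q"]) auto
qed

lemma simple_graph_query_edges: "simple_graph {..<4 * (q + 1)} (query_edges q m e w)"
  unfolding simple_graph_def using query_edge_pair by fastforce

lemma bit_query_disjoint: "set (bit_stream q X) \<inter> query_edges q m e w = {}"
proof -
  have False if "f = bit_edge X (i, c)" "i < q" "f \<in> query_edges q m e w" for f i c
  proof -
    have "\<forall>v\<in>f. v div 4 = i" by (auto simp: that(1) bit_edge_def)
    then show False using query_edge_pair[OF that(3)] that(2) by auto
  qed
  then show ?thesis unfolding set_bit_stream by auto
qed

text \<open>Each set accounts for at most \<open>2 * (k - 1)\<close> chain edges and two root edges;
  each of the \<open>q + 1 - k * m\<close> remaining blocks, the root's included, for at most four
  edges.\<close>

lemma card_query_edges: "card (query_edges q m e w) \<le> 2 * k * m + 4 * (q + 1 - k * m)"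
proof -
  let ?U = "\<Union>j<m. e j"
  let ?S = "{v. v < 4 * (q + 1) \<and> v \<noteq> 4 * q \<and> v div 4 \<notin> ?U}"
  have U: "?U \<subseteq> {..<q + 1}" using family_props(3) by force
  have "?S \<subseteq> (\<lambda>(i, d). 4 * i + d) ` (({..<q + 1} - ?U) \<times> {..<4})"
  proof
    fix v assume "v \<in> ?S"
    then have "(v div 4, v mod 4) \<in> ({..<q + 1} - ?U) \<times> {..<4}" by auto
    moreover have "v = (\<lambda>(i, d). 4 * i + d) (v div 4, v mod 4)" by simp
    ultimately show "v \<in> (\<lambda>(i, d). 4 * i + d) ` (({..<q + 1} - ?U) \<times> {..<4})" by blast
  qed
  then have "card ?S \<le> card (({..<q + 1} - ?U) \<times> {..<4::nat})"
    by (rule surj_card_le[rotated]) simp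
  also have "\<dots> = 4 * (q + 1 - k * m)"
    using U by (simp add: card_cartesian_product card_Diff_subset finite_subset card_family_Union)
  finally have S: "card ((\<lambda>v. {v, 4 * q}) ` ?S) \<le> 4 * (q + 1 - k * m)"
    using card_image_le[of ?S "\<lambda>v. {v, 4 * q}"] by (auto intro: le_trans)
  let ?C = "\<lambda>j. chain_edges (e j) \<union> {{4 * Min (e j), 4 * q}, {4 * Max (e j) + 2 + of_bool (w j), 4 * q}}"
  have "card (?C j) \<le> 2 * k" if "j < m" for j
  proof -
    note p = family_props[OF that]
    have "card (chain_edges (e j)) \<le> card ((e j - {Max (e j)}) \<times> (UNIV :: bool set))"
      unfolding chain_edges_def using p by (intro card_image_le) auto
    also have "\<dots> = 2 * (k - 1)" using p by (simp add: card_cartesian_product)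
    finally have "card (chain_edges (e j)) \<le> 2 * (k - 1)" .
    moreover have "card {{4 * Min (e j), 4 * q}, {4 * Max (e j) + 2 + of_bool (w j), 4 * q}} \<le> 2"
      by (simp add: card_insert_if)
    ultimately show ?thesis
      using card_Un_le[of "chain_edges (e j)" "{{4 * Min (e j), 4 * q}, {4 * Max (e j) + 2 + of_bool (w j), 4 * q}}"] k
      by linarith
  qed
  then have "(\<Sum>j<m. card (?C j)) \<le> (\<Sum>j<m. 2 * k)" by (intro sum_mono) auto
  then have "card (\<Union>j<m. ?C j) \<le> (\<Sum>j<m. 2 * k)"
    using card_UN_le[of "{..<m}" ?C] by (blast intro: le_trans finite_lessThan)
  then have "card (\<Union>j<m. ?C j) \<le> 2 * k * m"
    by (simp only: sum_constant card_lessThan mult.commute of_nat_id)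
  then show ?thesis
    unfolding query_edges_def using S card_Un_le[of "\<Union>j<m. ?C j" "(\<lambda>v. {v, 4 * q}) ` ?S"] by linarith
qed

lemma on_far_path_a: "on_far_path X T (4 * i + of_bool c) \<longleftrightarrow> c \<noteq> prefix_parity X T i"
  unfolding on_far_path_def block_arith by (cases c) simp_all

lemma on_far_path_b: "on_far_path X T (4 * i + 2 + of_bool c) \<longleftrightarrow> c \<noteq> prefix_parity X T (Suc i)"
  unfolding on_far_path_def block_arith by (cases c) simp_all

lemma component_label_far:
  assumes "j < m" "v div 4 \<in> e j" "on_far_path X (e j) v"
  shows "component_label m e X v = Suc j"
proof -
  have "component_label m e X v = (\<Sum>i<m. if i = j then Suc j else 0)"
    unfolding component_label_def using assms family_disjoint by (intro sum.cong refl) auto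
  then show ?thesis using assms(1) by simp
qed

lemma component_label_near:
  assumes "\<And>j. j < m \<Longrightarrow> v div 4 \<in> e j \<Longrightarrow> \<not> on_far_path X (e j) v"
  shows "component_label m e X v = 0"
  unfolding component_label_def using assms by (intro sum.neutral) auto

lemma component_label_root: "component_label m e X (4 * q) = 0"
  using family_props(3) by (intro component_label_near) auto

text \<open>In a block of a set, the edges cross and the prefix parity changes exactly when
  \<open>i \<in> X\<close>, and the two effects cancel.\<close>

lemma component_label_bit_edge:
  "component_label m e X (4 * i + of_bool c) = component_label m e X (4 * i + 2 + of_bool (c \<noteq> (i \<in> X)))"
  unfolding component_label_def on_far_path_a on_far_path_b block_arith
  by (intro sum.cong refl) (auto simp: prefix_parity_Suc)

text \<open>Chain edges preserve the prefix parity. When the query bits agree with the parities,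
  both the start vertex and the chosen end vertex joined to the root lie on the near path.\<close>

lemma component_label_query_edge:
  assumes w: "\<And>j. j < m \<Longrightarrow> w j = odd (card (X \<inter> e j))" and f: "{x, y} \<in> query_edges q m e w"
  shows "component_label m e X x = component_label m e X y"
proof -
  have eq: "component_label m e X x = component_label m e X y"
    if "{x, y} = {u, v}" "component_label m e X u = component_label m e X v" for u v
    using that by (auto simp: doubleton_eq_iff)
  from f show ?thesis
  proof (cases rule: query_edge_cases)
    case (chain j i c)
    note p = family_props[OF chain(1)]
    have n: "next_in (e j) i \<in> e j" using next_in p chain by blast
    have "component_label m e X (4 * i + 2 + of_bool c) = component_label m e X (4 * next_in (e j) i + of_bool c)"
      unfolding component_label_def on_far_path_a on_far_path_b block_arith
    proof (intro sum.cong refl)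
      fix l assume "l \<in> {..<m}"
      then have "i \<in> e l \<longleftrightarrow> l = j" "next_in (e j) i \<in> e l \<longleftrightarrow> l = j"
        using n chain family_disjoint by blast+
      then show "(if i \<in> e l \<and> c \<noteq> prefix_parity X (e l) (Suc i) then Suc l else 0) =
          (if next_in (e j) i \<in> e l \<and> c \<noteq> prefix_parity X (e l) (next_in (e j) i) then Suc l else 0)"
        using prefix_parity_next_in[OF p(1) chain(2,3), of X] by simp
    qed
    then show ?thesis using eq chain(4) by blast
  next
    case (first j)
    note p = family_props[OF first(1)]
    have "component_label m e X (4 * Min (e j) + of_bool False) = 0"
    proof (rule component_label_near, unfold block_arith on_far_path_a)
      fix l assume "l < m" "Min (e j) \<in> e l"
      then have "l = j" using family_disjoint p first(1) Min_in by blast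
      then show "\<not> (False \<noteq> prefix_parity X (e l) (Min (e j)))"
        using prefix_parity_Min[OF p(1)] by simp
    qed
    then show ?thesis using eq[OF first(2)] component_label_root by simp
  next
    case (last j)
    note p = family_props[OF last(1)]
    have "component_label m e X (4 * Max (e j) + 2 + of_bool (w j)) = 0"
    proof (rule component_label_near, unfold block_arith on_far_path_b)
      fix l assume "l < m" "Max (e j) \<in> e l"
      then have "l = j" using family_disjoint p last(1) Max_in by blast
      then show "\<not> (w j \<noteq> prefix_parity X (e l) (Suc (Max (e j))))"
        using prefix_parity_Max[OF p(1)] w[OF last(1)] by simp
    qed
    then show ?thesis using eq[OF last(2)] component_label_root by simp
  next
    case (star v)
    then have "component_label m e X v = 0" by (intro component_label_near) auto
    then show ?thesis using eq[OF star(4)] component_label_root by simp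
  qed
qed

text \<open>Labels are constant along edges and take all \<open>m + 1\<close> values from 0 to
  \<open>m\<close>, so a connected graph contains at least \<open>m\<close> edges that this one
  lacks. The second condition on \<delta> compares \<open>m\<close> with the bound on the number of
  edges.\<close>

lemma far_instance:
  assumes w: "\<And>j. j < m \<Longrightarrow> w j = odd (card (X \<inter> e j))"
    and \<delta>: "\<delta> \<ge> 0" "\<delta> * real (2 * q + (2 * k * m + 4 * (q + 1 - k * m))) < real m"
  shows "far_from_connected \<delta> {..<4 * (q + 1)} (set (bit_stream q X) \<union> query_edges q m e w)"
  unfolding far_from_connected_def
proof (intro allI impI, elim conjE)
  let ?V = "{..<4 * (q + 1)}"
  let ?E = "set (bit_stream q X) \<union> query_edges q m e w"
  let ?lab = "component_label m e X"
  fix E' assume E': "simple_graph ?V E'" "connected_graph ?V E'"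
  have fin: "finite F" if "simple_graph ?V F" for F
  proof (rule finite_subset)
    show "F \<subseteq> Pow ?V" using that by (auto simp: simple_graph_def)
  qed simp
  have finE: "finite ?E" using fin[OF simple_graph_query_edges] by simp
  have lab: "?lab x = ?lab y" if "{x, y} \<in> ?E" for x y
    using that
  proof
    assume "{x, y} \<in> set (bit_stream q X)"
    then obtain i c where "{x, y} = {4 * i + of_bool c, 4 * i + 2 + of_bool (c \<noteq> (i \<in> X))}"
      by (auto simp: set_bit_stream bit_edge_def)
    then show ?thesis using component_label_bit_edge[of X i c] by (auto simp only: doubleton_eq_iff)
  qed (rule component_label_query_edge[OF w])
  have "card (?lab ` ?V) \<le> card (E' - ?E) + 1"
  proof (rule connected_graph_card_labels[OF _ _ E'(2)])
    show "?lab x = ?lab y" if "{x, y} \<in> E' - (E' - ?E)" for x y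
      using that by (intro lab) blast
  qed (use fin[OF E'(1)] in auto)
  moreover have "{..m} \<subseteq> ?lab ` ?V"
  proof
    fix l assume "l \<in> {..m}"
    show "l \<in> ?lab ` ?V"
    proof (cases l)
      case 0
      then show ?thesis using component_label_root[of X] by (intro image_eqI[of _ _ "4 * q"]) auto
    next
      case (Suc j)
      then have j: "j < m" using \<open>l \<in> {..m}\<close> by simp
      note p = family_props[OF j]
      have "Min (e j) \<in> e j" using p by simp
      moreover from this have "Min (e j) < q" using p(3) by blast
      moreover have "?lab (4 * Min (e j) + of_bool True) = Suc j"
        by (rule component_label_far[OF j], unfold block_arith on_far_path_a)
           (use p prefix_parity_Min[OF p(1)] in auto)
      ultimately show ?thesis using Suc by (intro image_eqI[of _ _ "4 * Min (e j) + of_bool True"]) auto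
    qed
  qed
  then have "card {..m} \<le> card (?lab ` ?V)" by (intro card_mono) auto
  ultimately have "m \<le> card (E' - ?E)" by simp
  also have "\<dots> \<le> card ((?E - E') \<union> (E' - ?E))"
    using finE fin[OF E'(1)] by (intro card_mono) auto
  finally have ge: "real m \<le> real (card ((?E - E') \<union> (E' - ?E)))" by simp
  have "card ?E \<le> length (bit_stream q X) + card (query_edges q m e w)"
    using card_Un_le[of "set (bit_stream q X)" "query_edges q m e w"] card_length[of "bit_stream q X"] by linarith
  then have "card ?E \<le> 2 * q + (2 * k * m + 4 * (q + 1 - k * m))"
    using card_query_edges[of w] length_bit_stream[of q X] by linarith
  then have "\<delta> * real (card ?E) \<le> \<delta> * real (2 * q + (2 * k * m + 4 * (q + 1 - k * m)))"
    using \<delta>(1) by (intro mult_left_mono) (auto simp only: of_nat_le_iff)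
  then show "\<delta> * real (card ?E) < real (card ((?E - E') \<union> (E' - ?E)))"
    using ge \<delta>(2) by linarith
qed

text \<open>The near path reaches the root through its start. A flipped query bit joins the end of
  the far path to the root as well.\<close>

lemma connected_instance:
  assumes w: "\<And>j. j < m \<Longrightarrow> w j \<noteq> odd (card (X \<inter> e j))"
  shows "connected_graph {..<4 * (q + 1)} (set (bit_stream q X) \<union> query_edges q m e w)"
proof -
  let ?E = "set (bit_stream q X) \<union> query_edges q m e w"
  define r where "r = {(x, y). {x, y} \<in> ?E}"
  have sym: "sym (r\<^sup>*)" by (intro sym_rtrancl) (auto simp: sym_def r_def insert_commute)
  have bit: "(4 * i + of_bool c, 4 * i + 2 + of_bool (c \<noteq> (i \<in> X))) \<in> r\<^sup>*"
       "(4 * i + 2 + of_bool c, 4 * i + of_bool (c \<noteq> (i \<in> X))) \<in> r\<^sup>*" if "i < q" for i c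
  proof -
    show *: "(4 * i + of_bool c, 4 * i + 2 + of_bool (c \<noteq> (i \<in> X))) \<in> r\<^sup>*" for c
    proof -
      have "bit_edge X (i, c) \<in> set (bit_stream q X)" using that by (simp add: set_bit_stream)
      then show ?thesis unfolding bit_edge_def case_prod_conv by (intro r_into_rtrancl) (simp add: r_def)
    qed
    show "(4 * i + 2 + of_bool c, 4 * i + of_bool (c \<noteq> (i \<in> X))) \<in> r\<^sup>*"
      using symD[OF sym *[of "c \<noteq> (i \<in> X)"]] by (cases "i \<in> X") simp_all
  qed
  have query: "(x, y) \<in> r\<^sup>*" if "{x, y} \<in> query_edges q m e w" for x y
    using that by (auto simp: r_def)
  have in_tuple: "(4 * i + of_bool c, 4 * q) \<in> r\<^sup>*" if j: "j < m" and i: "i \<in> e j" for i j c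
  proof -
    note p = family_props[OF j]
    let ?P = "prefix_parity X (e j)"
    have chain: "(4 * i + 2 + of_bool c, 4 * next_in (e j) i + of_bool c) \<in> r\<^sup>*"
      if "i \<in> e j" "i \<noteq> Max (e j)" for i c
    proof (rule query)
      have "{4 * i + 2 + of_bool c, 4 * next_in (e j) i + of_bool c} \<in> chain_edges (e j)"
        unfolding chain_edges_def by (rule image_eqI[of _ _ "(i, c)"]) (use that in auto)
      then show "{4 * i + 2 + of_bool c, 4 * next_in (e j) i + of_bool c} \<in> query_edges q m e w"
        using j unfolding query_edges_def by blast
    qed
    \<comment> \<open>Induction upwards from \<open>Min (e j)\<close>, stepping back to the
      predecessor block.\<close>
    have near: "(4 * i + of_bool (?P i), 4 * q) \<in> r\<^sup>*" if "i \<in> e j" for i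
      using that
    proof (induction i rule: less_induct)
      case (less i)
      show ?case
      proof (cases "i = Min (e j)")
        case True
        then have "\<not> ?P i" using prefix_parity_Min p by simp
        moreover have "(4 * i, 4 * q) \<in> r\<^sup>*"
          using j True by (intro query) (auto simp: query_edges_def)
        ultimately show ?thesis by simp
      next
        case False
        obtain h where h: "h \<in> e j" "h \<noteq> Max (e j)" "h < i" "next_in (e j) h = i"
          using next_in_surj[OF p(1) less.prems False] .
        have P: "?P i = ?P (Suc h)" using prefix_parity_next_in[OF p(1) h(1,2), of X] h(4) by simp
        have "(4 * i + of_bool (?P i), 4 * h + 2 + of_bool (?P (Suc h))) \<in> r\<^sup>*"
          using symD[OF sym chain[OF h(1,2), of "?P i"]] h(4) P by simp
        moreover have "(4 * h + 2 + of_bool (?P (Suc h)), 4 * h + of_bool (?P h)) \<in> r\<^sup>*"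
          using bit(2)[of h "?P (Suc h)"] h(1) p(3) prefix_parity_Suc[OF h(1), of X]
          by (cases "h \<in> X") auto
        ultimately show ?thesis using less.IH[OF h(3,1)] by (meson rtrancl_trans)
      qed
    qed
    \<comment> \<open>Induction downwards from \<open>Max (e j)\<close>, stepping on to the next
      block; the query bit enters only at \<open>Max (e j)\<close>.\<close>
    have far: "(4 * i + of_bool (\<not> ?P i), 4 * q) \<in> r\<^sup>*" if "i \<in> e j" for i
      using that
    proof (induction "Max (e j) - i" arbitrary: i rule: less_induct)
      case less
      have *: "(4 * i + of_bool (\<not> ?P i), 4 * i + 2 + of_bool (\<not> ?P (Suc i))) \<in> r\<^sup>*"
        using bit(1)[of i "\<not> ?P i"] less.prems p(3) prefix_parity_Suc[OF less.prems, of X]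
        by (cases "i \<in> X") auto
      show ?case
      proof (cases "i = Max (e j)")
        case True
        then have "w j = (\<not> ?P (Suc i))" using w[OF j] prefix_parity_Max[OF p(1), of X] by simp
        then have "(4 * i + 2 + of_bool (\<not> ?P (Suc i)), 4 * q) \<in> r\<^sup>*"
          using j True by (intro query) (auto simp: query_edges_def)
        then show ?thesis using * by (meson rtrancl_trans)
      next
        case False
        note n = next_in[OF p(1) less.prems False]
        have "next_in (e j) i \<le> Max (e j)" using n(1) p(1) by simp
        then have "(4 * next_in (e j) i + of_bool (\<not> ?P (next_in (e j) i)), 4 * q) \<in> r\<^sup>*"
          using n by (intro less.hyps) auto
        moreover have "(4 * i + 2 + of_bool (\<not> ?P (Suc i)), 4 * next_in (e j) i + of_bool (\<not> ?P (next_in (e j) i))) \<in> r\<^sup>*"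
          using chain[OF less.prems False, of "\<not> ?P (Suc i)"] prefix_parity_next_in[OF p(1) less.prems False, of X] by simp
        ultimately show ?thesis using * by (meson rtrancl_trans)
      qed
    qed
    show ?thesis using near[OF i] far[OF i] by (cases "c = ?P i") auto
  qed
  have root: "(v, 4 * q) \<in> r\<^sup>*" if "v < 4 * (q + 1)" for v
  proof (cases "v div 4 \<in> (\<Union>j<m. e j)")
    case True
    then obtain j where j: "j < m" "v div 4 \<in> e j" by blast
    then have "v div 4 < q" using family_props(3) by auto
    show ?thesis
    proof (cases v rule: vertex_cases)
      case (1 c)
      then show ?thesis using in_tuple[OF j, of c] by metis
    next
      case (2 c)
      then show ?thesis using in_tuple[OF j] bit(2)[OF \<open>v div 4 < q\<close>, of c] by (metis rtrancl_trans)
    qed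
  next
    case False
    then show ?thesis using that
      by (cases "v = 4 * q") (auto intro!: query simp: query_edges_def)
  qed
  have "(u, v) \<in> r\<^sup>*" if "u < 4 * (q + 1)" "v < 4 * (q + 1)" for u v
    using root[OF that(1)] symD[OF sym root[OF that(2)]] by (rule rtrancl_trans)
  then show ?thesis unfolding connected_graph_def r_def by auto
qed

end

section \<open>The hybrid argument\<close>

lemma sum_Pow_Un_disjoint:
  fixes f :: "'a set \<Rightarrow> real"
  assumes "finite A" "finite B" "A \<inter> B = {}"
  shows "(\<Sum>X\<in>Pow (A \<union> B). f X) = (\<Sum>Y\<in>Pow A. \<Sum>Z\<in>Pow B. f (Y \<union> Z))"
proof -
  have "(\<Sum>Y\<in>Pow A. \<Sum>Z\<in>Pow B. f (Y \<union> Z)) = (\<Sum>(Y, Z)\<in>Pow A \<times> Pow B. f (Y \<union> Z))"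
    by (rule sum.cartesian_product)
  also have "\<dots> = (\<Sum>X\<in>Pow (A \<union> B). f X)"
    by (rule sum.reindex_bij_witness[of _ "\<lambda>X. (X \<inter> A, X \<inter> B)" "\<lambda>(Y, Z). Y \<union> Z"])
       (use assms(3) in auto)
  finally show ?thesis by simp
qed

lemma finite_disjoint_families: "finite (disjoint_families q m k)"
proof (rule finite_subset)
  show "disjoint_families q m k \<subseteq> {e. \<forall>j. (j \<in> {..<m} \<longrightarrow> e j \<in> Pow {..<q}) \<and> (j \<notin> {..<m} \<longrightarrow> e j = {})}"
    by (auto simp: disjoint_families_def)
qed (rule finite_set_of_finite_funs; simp)

lemma disjoint_families_nonempty:
  assumes "k * m \<le> q"
  shows "disjoint_families q m k \<noteq> {}"
proof -
  have "(\<lambda>j. if j < m then {k * j..<k * j + k} else {}) \<in> disjoint_families q m k"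
  proof -
    have "k * j + k \<le> q" if "j < m" for j
    proof -
      have "k * Suc j \<le> k * m" using that by (intro mult_le_mono2) simp
      then show ?thesis using assms by simp
    qed
    moreover have "{k * i..<k * i + k} \<inter> {k * j..<k * j + k} = {}" if "i < j" for i j
    proof -
      have "k * Suc i \<le> k * j" using that by (intro mult_le_mono2) simp
      then show ?thesis by auto
    qed
    then have "{k * i..<k * i + k} \<inter> {k * j..<k * j + k} = {}" if "i \<noteq> j" for i j
      using that by (metis Int_commute nat_neq_iff)
    ultimately show ?thesis unfolding disjoint_families_def by fastforce
  qed
  then show ?thesis by blast
qed

text \<open>The coordinates available to the \<open>h\<close>-th set once the others are fixed; in a
  disjoint family its own elements are among them.\<close>

definition free_coords :: "nat \<Rightarrow> nat \<Rightarrow> nat \<Rightarrow> (nat \<Rightarrow> nat set) \<Rightarrow> nat set" where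
  "free_coords q m h e = {..<q} - (\<Union>i\<in>{..<m} - {h}. e i)"

lemma card_free_coords:
  assumes e: "e \<in> disjoint_families q m k" and "h < m"
  shows "card (free_coords q m h e) = q - k * (m - 1)"
proof -
  have "card (\<Union>i\<in>{..<m} - {h}. e i) = (\<Sum>i\<in>{..<m} - {h}. card (e i))"
    using e by (intro card_UN_disjoint) (auto simp: disjoint_families_def intro: finite_subset)
  also have "\<dots> = (\<Sum>i\<in>{..<m} - {h}. k)"
    using e by (intro sum.cong) (auto simp: disjoint_families_def)
  also have "\<dots> = k * (m - 1)" using \<open>h < m\<close> by simp
  finally have *: "card (\<Union>i\<in>{..<m} - {h}. e i) = k * (m - 1)" .
  have sub: "(\<Union>i\<in>{..<m} - {h}. e i) \<subseteq> {..<q}"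
    using e by (auto simp: disjoint_families_def)
  then have "finite (\<Union>i\<in>{..<m} - {h}. e i)" by (rule finite_subset) simp
  then show ?thesis unfolding free_coords_def
    using card_Diff_subset[OF _ sub] * by simp
qed

lemma free_coords_upd: "free_coords q m h (e(h := T)) = free_coords q m h e"
  by (auto simp: free_coords_def)

lemma disjoint_families_upd:
  assumes e: "e \<in> disjoint_families q m k" and "h < m" "T \<subseteq> free_coords q m h e" "card T = k"
  shows "e(h := T) \<in> disjoint_families q m k"
proof -
  have "T \<subseteq> {..<q}" "\<And>i. i < m \<Longrightarrow> i \<noteq> h \<Longrightarrow> T \<inter> e i = {}"
    using assms(3) by (auto simp: free_coords_def)
  then show ?thesis using assms unfolding disjoint_families_def
    by (simp add: Int_commute)
qed

lemma family_member_free: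
  assumes e: "e \<in> disjoint_families q m k" and "h < m"
  shows "e h \<subseteq> free_coords q m h e" "card (e h) = k"
proof -
  have "e h \<inter> e i = {}" if "i < m" "i \<noteq> h" for i
    using that assms unfolding disjoint_families_def by blast
  then have "e h \<inter> (\<Union>i\<in>{..<m} - {h}. e i) = {}" by blast
  moreover have "e h \<subseteq> {..<q}" "card (e h) = k"
    using assms by (simp_all add: disjoint_families_def)
  ultimately show "e h \<subseteq> free_coords q m h e" "card (e h) = k"
    unfolding free_coords_def by blast+
qed

text \<open>Replacing the \<open>h\<close>-th set by a random subset of the free coordinates preserves the uniform
  distribution, because swapping the old set with the new one is an involution.\<close>

lemma sum_disjoint_families_resample:
  fixes G :: "(nat \<Rightarrow> nat set) \<Rightarrow> real"
  assumes "h < m"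
  shows "(\<Sum>e\<in>disjoint_families q m k. \<Sum>T | T \<subseteq> free_coords q m h e \<and> card T = k. G (e(h := T))) =
         real ((q - k * (m - 1)) choose k) * (\<Sum>e\<in>disjoint_families q m k. G e)"
proof -
  let ?\<Omega> = "disjoint_families q m k"
  let ?\<T> = "\<lambda>e. {T. T \<subseteq> free_coords q m h e \<and> card T = k}"
  have fin: "finite (free_coords q m h e)" for e by (simp add: free_coords_def)
  have finT: "finite (?\<T> e)" for e
    by (rule finite_subset[of _ "Pow (free_coords q m h e)"]) (use fin in auto)
  have "(\<Sum>e\<in>?\<Omega>. \<Sum>T\<in>?\<T> e. G (e(h := T))) = (\<Sum>(e, T)\<in>Sigma ?\<Omega> ?\<T>. G (e(h := T)))"
    using finT finite_disjoint_families by (intro sum.Sigma) auto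
  also have "\<dots> = (\<Sum>(e, T)\<in>Sigma ?\<Omega> ?\<T>. G e)"
    by (rule sum.reindex_bij_witness[of _ "\<lambda>(e, T). (e(h := T), e h)" "\<lambda>(e, T). (e(h := T), e h)"])
       (use assms in \<open>auto simp: free_coords_upd disjoint_families_upd family_member_free
          dest: subsetD[OF family_member_free(1)]\<close>)
  also have "\<dots> = (\<Sum>e\<in>?\<Omega>. \<Sum>T\<in>?\<T> e. G e)"
    using finT finite_disjoint_families by (intro sum.Sigma[symmetric]) auto
  also have "\<dots> = (\<Sum>e\<in>?\<Omega>. real ((q - k * (m - 1)) choose k) * G e)"
    using assms fin by (intro sum.cong refl) (simp add: n_subsets card_free_coords)
  finally show ?thesis by (simp add: sum_distrib_left)
qed

text \<open>Bits below \<open>h\<close> contradict the parities, the others agree: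
  \<open>h = 0\<close> gives the far instances, \<open>h = m\<close> the connected ones.\<close>

definition hybrid_bits :: "nat \<Rightarrow> nat set \<Rightarrow> (nat \<Rightarrow> nat set) \<Rightarrow> nat \<Rightarrow> bool" where
  "hybrid_bits h X e j \<longleftrightarrow> (j < h) \<noteq> odd (card (X \<inter> e j))"

section \<open>Advantage of a message for one flip and for all flips\<close>

context
  fixes acc :: "bool list \<Rightarrow> (nat \<Rightarrow> nat set) \<Rightarrow> (nat \<Rightarrow> bool) \<Rightarrow> real"
    and \<mu> :: "nat set \<Rightarrow> bool list" and q m t s :: nat
  assumes acc: "\<And>b e w. 0 \<le> acc b e w" "\<And>b e w. acc b e w \<le> 1"
    and \<mu>: "\<And>X. X \<subseteq> {..<q} \<Longrightarrow> length (\<mu> X) \<le> s"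
    and t: "t \<ge> 1" and fit: "2 * t * m \<le> q"
begin

text \<open>Neighbouring hybrids differ in bit \<open>h\<close> alone, so their difference is the
  Walsh function of \<open>e h\<close> at \<open>X\<close> times a quantity \<Delta>. Once
  \<open>e h\<close> is resampled as \<open>T\<close> and \<open>X\<close> is split into
  \<open>Y\<close> outside the free coordinates and \<open>Z\<close> on them, \<Delta> sees
  \<open>Z\<close> only through the message, and \<open>walsh_correlation_bound_bits\<close>
  applies.\<close>

lemma hybrid_step_bound:
  assumes "h < m"
  shows "(\<Sum>e\<in>disjoint_families q m (2 * t). \<Sum>X\<in>Pow {..<q}.
            acc (\<mu> X) e (hybrid_bits (Suc h) X e) - acc (\<mu> X) e (hybrid_bits h X e)) \<le>
         real (card (disjoint_families q m (2 * t))) * 2 ^ q *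
           (2 * (4 * real t * real s / real (q - 2 * t * (m - 1))) ^ t)"
proof -
  let ?\<Omega> = "disjoint_families q m (2 * t)"
  define N where "N = q - 2 * t * (m - 1)"
  define \<beta> where "\<beta> = 2 * (4 * real t * real s / real N) ^ t"
  define B where "B = real (N choose (2 * t))"
  have N: "2 * t \<le> N" "N \<le> q"
  proof -
    have "2 * t * m = 2 * t * (m - 1) + 2 * t" using \<open>h < m\<close> by (cases m) auto
    then show "2 * t \<le> N" "N \<le> q" using fit by (auto simp: N_def)
  qed
  have B: "B > 0" using N by (simp add: B_def)
  \<comment> \<open>Bit \<open>h\<close> is overwritten in both terms, so its value in
    \<open>w\<close> does not enter.\<close>
  define \<Delta> where "\<Delta> b e w = acc b e (w(h := True)) - acc b e (w(h := False))" for b e w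
  have \<Delta>: "\<bar>\<Delta> b e w\<bar> \<le> 1" for b e w
    using acc(1)[of b e "w(h := True)"] acc(2)[of b e "w(h := True)"]
      acc(1)[of b e "w(h := False)"] acc(2)[of b e "w(h := False)"]
    unfolding \<Delta>_def by linarith
  define G where "G e = (\<Sum>X\<in>Pow {..<q}. walsh (e h) X * \<Delta> (\<mu> X) e (hybrid_bits h X e))" for e
  have "(\<Sum>e\<in>?\<Omega>. \<Sum>X\<in>Pow {..<q}.
            acc (\<mu> X) e (hybrid_bits (Suc h) X e) - acc (\<mu> X) e (hybrid_bits h X e)) = (\<Sum>e\<in>?\<Omega>. G e)"
    unfolding G_def
  proof (intro sum.cong refl)
    fix e :: "nat \<Rightarrow> nat set" and X :: "nat set"
    let ?o = "odd (card (X \<inter> e h))"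
    have 1: "hybrid_bits (Suc h) X e = (hybrid_bits h X e)(h := \<not> ?o)"
      by (auto simp: fun_eq_iff hybrid_bits_def)
    have 2: "hybrid_bits h X e = (hybrid_bits h X e)(h := ?o)"
      by (auto simp: fun_eq_iff hybrid_bits_def)
    have w: "walsh (e h) X = (if ?o then -1 else 1)"
      by (simp add: walsh_def Int_commute)
    show "acc (\<mu> X) e (hybrid_bits (Suc h) X e) - acc (\<mu> X) e (hybrid_bits h X e) =
        walsh (e h) X * \<Delta> (\<mu> X) e (hybrid_bits h X e)"
      by (subst 1, subst (2) 2) (cases ?o; simp add: w \<Delta>_def)
  qed
  also have "\<dots> \<le> real (card ?\<Omega>) * 2 ^ q * \<beta>"
  proof -
    \<comment> \<open>\<open>B\<close> is the number of choices of \<open>T\<close> for each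
      family.\<close>
    have "B * (\<Sum>e\<in>?\<Omega>. G e) =
        (\<Sum>e\<in>?\<Omega>. \<Sum>T | T \<subseteq> free_coords q m h e \<and> card T = 2 * t. G (e(h := T)))"
      using sum_disjoint_families_resample[OF \<open>h < m\<close>, of G q "2 * t"] by (simp add: B_def N_def)
    also have "\<dots> \<le> (\<Sum>e\<in>?\<Omega>. 2 ^ q * (B * \<beta>))"
    proof (rule sum_mono)
      fix e assume e: "e \<in> ?\<Omega>"
      define R where "R = free_coords q m h e"
      define A where "A = {..<q} - R"
      have R: "finite R" "R \<subseteq> {..<q}" "card R = N"
        using card_free_coords[OF e \<open>h < m\<close>] by (auto simp: R_def N_def free_coords_def)
      have A: "finite A" "A \<inter> R = {}" "A \<union> R = {..<q}" using R by (auto simp: A_def)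
      have cA: "card A = q - N" unfolding A_def using R by (simp add: card_Diff_subset)
      define D where "D Y b T = \<Delta> b (e(h := T)) (hybrid_bits h Y e)" for Y b T
      have "(\<Sum>T | T \<subseteq> R \<and> card T = 2 * t. G (e(h := T))) =
          (\<Sum>X\<in>Pow (A \<union> R). \<Sum>T | T \<subseteq> R \<and> card T = 2 * t.
             walsh T X * \<Delta> (\<mu> X) (e(h := T)) (hybrid_bits h X (e(h := T))))"
        unfolding G_def A(3) by (subst sum.swap) simp
      also have "\<dots> = (\<Sum>Y\<in>Pow A. \<Sum>Z\<in>Pow R. \<Sum>T | T \<subseteq> R \<and> card T = 2 * t.
             walsh T (Y \<union> Z) * \<Delta> (\<mu> (Y \<union> Z)) (e(h := T)) (hybrid_bits h (Y \<union> Z) (e(h := T))))"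
        using A R by (intro sum_Pow_Un_disjoint) auto
      also have "\<dots> = (\<Sum>Y\<in>Pow A. \<Sum>Z\<in>Pow R. \<Sum>T | T \<subseteq> R \<and> card T = 2 * t.
             walsh T Z * D Y (\<mu> (Y \<union> Z)) T)"
      proof (intro sum.cong refl)
        fix Y Z T assume Y: "Y \<in> Pow A" and Z: "Z \<in> Pow R" and T: "T \<in> {T. T \<subseteq> R \<and> card T = 2 * t}"
        have "T \<inter> (Y \<union> Z) = T \<inter> Z" using Y T A by auto
        then have 1: "walsh T (Y \<union> Z) = walsh T Z" by (simp add: walsh_def)
        \<comment> \<open>The other sets avoid the free coordinates, or are empty from index
          \<open>m\<close> on, so they meet only \<open>Y\<close>.\<close>
        have "(Y \<union> Z) \<inter> e j = Y \<inter> e j" if "j \<noteq> h" for j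
        proof (cases "j < m")
          case True
          then show ?thesis using Z that by (auto simp: R_def free_coords_def)
        next
          case False
          then show ?thesis using e by (simp add: disjoint_families_def)
        qed
        then have "(hybrid_bits h (Y \<union> Z) (e(h := T)))(h := v) = (hybrid_bits h Y e)(h := v)" for v
          by (auto simp: fun_eq_iff hybrid_bits_def)
        then have 2: "\<Delta> b (e(h := T)) (hybrid_bits h (Y \<union> Z) (e(h := T))) = D Y b T" for b
          by (simp only: \<Delta>_def D_def)
        show "walsh T (Y \<union> Z) * \<Delta> (\<mu> (Y \<union> Z)) (e(h := T)) (hybrid_bits h (Y \<union> Z) (e(h := T))) =
            walsh T Z * D Y (\<mu> (Y \<union> Z)) T"
          by (simp only: 1 2)
      qed
      also have "\<dots> \<le> (\<Sum>Y\<in>Pow A. 2 ^ N * B * \<beta>)"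
      proof (rule sum_mono)
        fix Y assume "Y \<in> Pow A"
        then show "(\<Sum>Z\<in>Pow R. \<Sum>T | T \<subseteq> R \<and> card T = 2 * t. walsh T Z * D Y (\<mu> (Y \<union> Z)) T) \<le> 2 ^ N * B * \<beta>"
          unfolding B_def \<beta>_def R(3)[symmetric] using R N t A \<Delta>
          by (intro walsh_correlation_bound_bits) (auto simp: D_def intro!: \<mu>)
      qed
      also have "\<dots> = 2 ^ q * (B * \<beta>)"
      proof -
        have "(2::real) ^ q = 2 ^ (q - N) * 2 ^ N" using N by (simp flip: power_add)
        then show ?thesis using A(1) by (simp add: card_Pow cA)
      qed
      finally show "(\<Sum>T | T \<subseteq> free_coords q m h e \<and> card T = 2 * t. G (e(h := T))) \<le> 2 ^ q * (B * \<beta>)"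
        unfolding R_def .
    qed
    also have "\<dots> = B * (real (card ?\<Omega>) * 2 ^ q * \<beta>)" by simp
    finally show ?thesis using B by (simp only: mult_le_cancel_left_pos)
  qed
  finally show ?thesis by (simp only: \<beta>_def N_def)
qed

lemma hybrid_total_bound:
  "(\<Sum>e\<in>disjoint_families q m (2 * t). \<Sum>X\<in>Pow {..<q}.
      acc (\<mu> X) e (hybrid_bits m X e) - acc (\<mu> X) e (hybrid_bits 0 X e)) \<le>
   real m * (real (card (disjoint_families q m (2 * t))) * 2 ^ q *
      (2 * (4 * real t * real s / real (q - 2 * t * (m - 1))) ^ t))" (is "?L \<le> real m * ?b")
proof -
  have "?L = (\<Sum>e\<in>disjoint_families q m (2 * t). \<Sum>X\<in>Pow {..<q}. \<Sum>h<m.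
      acc (\<mu> X) e (hybrid_bits (Suc h) X e) - acc (\<mu> X) e (hybrid_bits h X e))"
    by (subst sum_lessThan_telescope) simp
  also have "\<dots> = (\<Sum>e\<in>disjoint_families q m (2 * t). \<Sum>h<m. \<Sum>X\<in>Pow {..<q}.
      acc (\<mu> X) e (hybrid_bits (Suc h) X e) - acc (\<mu> X) e (hybrid_bits h X e))"
    by (intro sum.cong refl sum.swap)
  also have "\<dots> = (\<Sum>h<m. \<Sum>e\<in>disjoint_families q m (2 * t). \<Sum>X\<in>Pow {..<q}.
      acc (\<mu> X) e (hybrid_bits (Suc h) X e) - acc (\<mu> X) e (hybrid_bits h X e))"
    by (rule sum.swap)
  also have "\<dots> \<le> (\<Sum>h<m. ?b)"
    by (intro sum_mono hybrid_step_bound) simp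
  finally show ?thesis by simp
qed

end

section \<open>Reduction from streaming algorithms\<close>

text \<open>Positions count from \<open>i\<close>, because updates may depend on the index in the
  whole stream.\<close>

definition resume :: "det_streaming_alg \<Rightarrow> nat \<Rightarrow> bool list \<Rightarrow> edge list \<Rightarrow> bool list" where
  "resume D i b \<sigma> = fold (\<lambda>(i, e). update_mem D i e) (List.enumerate i \<sigma>) b"

lemma final_mem_append: "final_mem D (\<sigma> @ \<tau>) = resume D (length \<sigma>) (final_mem D \<sigma>) \<tau>"
  by (simp add: final_mem_def resume_def enumerate_append_eq)

text \<open>An arbitrary but fixed order. It depends on the query edges alone, so \<open>X\<close>
  enters the second part only through the bits \<open>w\<close>.\<close>

definition query_stream :: "nat \<Rightarrow> nat \<Rightarrow> (nat \<Rightarrow> nat set) \<Rightarrow> (nat \<Rightarrow> bool) \<Rightarrow> edge list" where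
  "query_stream q m e w = (SOME \<sigma>. set \<sigma> = query_edges q m e w \<and> distinct \<sigma>)"

lemma query_stream:
  assumes "e \<in> disjoint_families q m k" "k \<ge> 1"
  shows "set (query_stream q m e w) = query_edges q m e w" "distinct (query_stream q m e w)"
proof -
  have "query_edges q m e w \<subseteq> Pow {..<4 * (q + 1)}"
    using simple_graph_query_edges[OF assms, of w] by (auto simp: simple_graph_def)
  then have "finite (query_edges q m e w)" by (rule finite_subset) simp
  then have "\<exists>\<sigma>. set \<sigma> = query_edges q m e w \<and> distinct \<sigma>" by (rule finite_distinct_list)
  from someI_ex[OF this] show "set (query_stream q m e w) = query_edges q m e w" "distinct (query_stream q m e w)"
    by (simp_all add: query_stream_def)
qed

text \<open>Connected and far instances differ in acceptance probability by at least
  \<open>p - (1 - p)\<close>. This gap is summed over all \<open>X\<close> and all families and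
  exchanged with the expectation over the coins; the hybrid bound then holds for every fixed outcome
  of the coins.\<close>

lemma streaming_space_tradeoff:
  assumes dist: "distinguishes_connected p \<delta> A {..<4 * (q + 1)}"
    and space: "uses_space A {..<4 * (q + 1)} s"
    and t: "t \<ge> 1" and fit: "2 * t * m \<le> q"
    and \<delta>: "\<delta> \<ge> 0" "\<delta> * real (2 * q + (2 * (2 * t) * m + 4 * (q + 1 - 2 * t * m))) < real m"
  shows "2 * p - 1 \<le> real m * (2 * (4 * real t * real s / real (q - 2 * t * (m - 1))) ^ t)"
proof -
  let ?V = "{..<4 * (q + 1)}"
  let ?\<Omega> = "disjoint_families q m (2 * t)"
  define \<beta> where "\<beta> = 2 * (4 * real t * real s / real (q - 2 * t * (m - 1))) ^ t"
  define str where "str X e w = bit_stream q X @ query_stream q m e w" for X e w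
  define acc :: "det_streaming_alg \<Rightarrow> bool list \<Rightarrow> (nat \<Rightarrow> nat set) \<Rightarrow> (nat \<Rightarrow> bool) \<Rightarrow> real"
    where "acc D b e w = of_bool (accepts D (resume D (2 * q) b (query_stream q m e w)))" for D b e w
  define \<mu> where "\<mu> D X = final_mem D (bit_stream q X)" for D X
  have k: "2 * t \<ge> 1" using t by simp
  have fm: "final_mem D (str X e w) = resume D (2 * q) (\<mu> D X) (query_stream q m e w)" for D X e w
    by (simp add: str_def final_mem_append \<mu>_def length_bit_stream)
  have int: "integrable (measure_pmf A) (\<lambda>D. acc D (\<mu> D X) e w)" for X e w
    by (rule measure_pmf.integrable_const_bound[where B = 1]) (auto simp: acc_def)
  have E_acc: "measure_pmf.expectation A (\<lambda>D. acc D (\<mu> D X) e w) =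
      measure_pmf.prob A {D. accepts D (final_mem D (str X e w))}" for X e w
  proof -
    have "(\<lambda>D. acc D (\<mu> D X) e w) = indicator {D. accepts D (final_mem D (str X e w))}"
      by (auto simp: fun_eq_iff acc_def fm indicator_def)
    then show ?thesis by simp
  qed
  have gap: "2 * p - 1 \<le> measure_pmf.expectation A (\<lambda>D. acc D (\<mu> D X) e (hybrid_bits m X e) - acc D (\<mu> D X) e (hybrid_bits 0 X e))"
    if e: "e \<in> ?\<Omega>" for X e
  proof -
    have stream: "insertion_stream (str X e w) (set (bit_stream q X) \<union> query_edges q m e w)"
      "simple_graph ?V (set (bit_stream q X) \<union> query_edges q m e w)" for w
      using query_stream[OF e k, of w] bit_query_disjoint[OF e k, of X w] distinct_bit_stream[of q X]
        simple_graph_bit_stream[of q X] simple_graph_query_edges[OF e k, of w]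
      by (auto simp: insertion_stream_def str_def simple_graph_def)
    have conn: "connected_graph ?V (set (bit_stream q X) \<union> query_edges q m e (hybrid_bits m X e))"
      by (rule connected_instance[OF e k]) (simp add: hybrid_bits_def)
    have far: "far_from_connected \<delta> ?V (set (bit_stream q X) \<union> query_edges q m e (hybrid_bits 0 X e))"
      by (rule far_instance[OF e k]) (use \<delta> in \<open>simp_all add: hybrid_bits_def\<close>)
    have yes: "measure_pmf.prob A {D. accepts D (final_mem D (str X e (hybrid_bits m X e)))} \<ge> p"
      using dist conn stream unfolding distinguishes_connected_def by blast
    have "measure_pmf.prob A {D. \<not> accepts D (final_mem D (str X e (hybrid_bits 0 X e)))} \<ge> p"
      using dist far stream unfolding distinguishes_connected_def by blast
    moreover have "measure_pmf.prob A {D. \<not> accepts D (final_mem D (str X e (hybrid_bits 0 X e)))} =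
        1 - measure_pmf.prob A {D. accepts D (final_mem D (str X e (hybrid_bits 0 X e)))}"
      using measure_pmf.prob_compl[of "{D. accepts D (final_mem D (str X e (hybrid_bits 0 X e)))}" A]
      by (simp add: Compl_eq_Diff_UNIV[symmetric] Collect_neg_eq)
    ultimately show ?thesis using yes int by (simp add: E_acc)
  qed
  let ?K = "real (card ?\<Omega>) * 2 ^ q"
  have "0 < card ?\<Omega>"
    using finite_disjoint_families disjoint_families_nonempty[OF fit] by (simp add: card_gt_0_iff)
  then have K: "?K > 0" by simp
  have "?K * (2 * p - 1) = (\<Sum>e\<in>?\<Omega>. \<Sum>X\<in>Pow {..<q}. 2 * p - 1)" by (simp add: card_Pow)
  also have "\<dots> \<le> (\<Sum>e\<in>?\<Omega>. \<Sum>X\<in>Pow {..<q}.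
      measure_pmf.expectation A (\<lambda>D. acc D (\<mu> D X) e (hybrid_bits m X e) - acc D (\<mu> D X) e (hybrid_bits 0 X e)))"
    by (intro sum_mono gap)
  also have "\<dots> = measure_pmf.expectation A (\<lambda>D. \<Sum>e\<in>?\<Omega>. \<Sum>X\<in>Pow {..<q}.
      acc D (\<mu> D X) e (hybrid_bits m X e) - acc D (\<mu> D X) e (hybrid_bits 0 X e))"
    using int by (simp add: Bochner_Integration.integral_sum)
  also have "\<dots> \<le> real m * (?K * \<beta>)"
  proof (rule measure_pmf.integral_le_const)
    show "AE D in measure_pmf A. (\<Sum>e\<in>?\<Omega>. \<Sum>X\<in>Pow {..<q}.
      acc D (\<mu> D X) e (hybrid_bits m X e) - acc D (\<mu> D X) e (hybrid_bits 0 X e)) \<le> real m * (?K * \<beta>)"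
    proof (rule AE_pmfI)
      fix D assume D: "D \<in> set_pmf A"
      \<comment> \<open>The first part is itself an insertion stream, so the space bound covers the
        memory at its end.\<close>
      have "length (\<mu> D X) \<le> s" for X
        using space D simple_graph_bit_stream[of q X] distinct_bit_stream[of q X]
        unfolding uses_space_def \<mu>_def insertion_stream_def by blast
      then show "(\<Sum>e\<in>?\<Omega>. \<Sum>X\<in>Pow {..<q}.
          acc D (\<mu> D X) e (hybrid_bits m X e) - acc D (\<mu> D X) e (hybrid_bits 0 X e)) \<le> real m * (?K * \<beta>)"
        unfolding \<beta>_def using t fit by (intro hybrid_total_bound) (auto simp: acc_def)
    qed
  qed (use int in auto)
  also have "\<dots> = ?K * (real m * \<beta>)" by simp
  finally show ?thesis using K unfolding \<beta>_def by (simp only: mult_le_cancel_left_pos)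
qed

text \<open>With \<open>m \<le> n\<close> and at least \<open>n / a\<close> free coordinates, the
  tradeoff becomes \<open>\<epsilon> \<le> n * (C * s / n) ^ t\<close>, which is solved for
  \<open>s\<close>. The constant depends on \<open>t\<close> and \<open>p\<close> only.\<close>

theorem theorem5p5:
  fixes t :: nat and p :: real
  assumes "t \<ge> 1" and "p > 1/2"
  shows "\<exists>c>0. \<forall>\<^sub>F n in sequentially. \<forall>(A :: streaming_alg) (s :: nat).
           distinguishes_connected p (1 / (8 * real t + 1)) A {..<4 * n} \<and>
           uses_space A {..<4 * n} s \<longrightarrow>
           real s \<ge> c * real n powr (1 - 1 / real t)"
proof -
  (* With m sets of size 2 t, the far graph needs m extra edges and has at most 6 n - 4 t m edges, so
     it is far if (12 t + 1) m > 6 n; a linear number of coordinates stays free if 2 t m < n minus a linear term.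
     The choice m = 12 n / (24 t + 1) meets both conditions. *)
  define a where "a = 24 * t + 1"
  define C where "C = 4 * real t * real a"
  define \<epsilon> where "\<epsilon> = p - 1/2"
  \<comment> \<open>Chosen so that \<open>s = c * n powr (1 - 1 / t)\<close> solves
    \<open>n * (C * s / n) ^ t = \<epsilon>\<close>.\<close>
  define c where "c = \<epsilon> powr (1 / real t) / C"
  have pos: "C > 0" "\<epsilon> > 0" "c > 0" using assms by (auto simp: C_def a_def \<epsilon>_def c_def)
  \<comment> \<open>The threshold on \<open>n\<close> yields \<open>m \<ge> a\<close>, the slack
    that absorbs the rounding in \<open>m\<close> and the loss from \<open>n\<close> to
    \<open>n - 1\<close>.\<close>
  have "real s \<ge> c * real n powr (1 - 1 / real t)"
    if n: "n \<ge> a\<^sup>2" and dist: "distinguishes_connected p (1 / (8 * real t + 1)) A {..<4 * n}"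
      and space: "uses_space A {..<4 * n} s" for n A s
  proof (rule ccontr)
    assume less: "\<not> real s \<ge> c * real n powr (1 - 1 / real t)"
    define m where "m = 12 * n div a"
    \<comment> \<open>One of the \<open>n\<close> blocks is set aside for the root.\<close>
    define q where "q = n - 1"
    have a: "a \<ge> 25" "a = 24 * t + 1" using assms(1) by (auto simp: a_def)
    have n0: "n > 0" using n a by (auto simp: power2_eq_square intro: Nat.gr0I)
    have q: "4 * n = 4 * (q + 1)" "n = q + 1" using n0 by (auto simp: q_def)
    have m1: "a * m \<le> 12 * n" by (simp add: m_def)
    have m2: "12 * n < a * m + a" 
      using a(1) mult_div_mod_eq[of a "12 * n"] mod_less_divisor[of a "12 * n"] unfolding m_def by linarith
    have m3: "a \<le> m"
    proof -
      have "a * a \<le> 12 * n" using n by (simp add: power2_eq_square)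
      then show ?thesis unfolding m_def using a(1) by (simp add: less_eq_div_iff_mult_less_eq)
    qed
    \<comment> \<open>\<open>24 * t * m + m \<le> 12 * n\<close> and \<open>m \<ge> 12\<close> give
      \<open>2 * t * m \<le> n - 1\<close>.\<close>
    have fit: "2 * t * m \<le> q" using m1 m3 a q(2) by (simp add: algebra_simps)
    have "m \<le> n" using fit q(2) assms(1) by (cases t) auto
    \<comment> \<open>The edge bound is \<open>6 * n - 2 - 4 * t * m\<close>, so
      \<open>(12 * t + 1) * m > 6 * n - 2\<close> is needed. Twice the left side is
      \<open>a * m + m\<close>, which exceeds \<open>12 * n\<close> by \<open>m2\<close> and
      \<open>m3\<close>.\<close>
    have \<delta>: "1 / (8 * real t + 1) * real (2 * q + (2 * (2 * t) * m + 4 * (q + 1 - 2 * t * m))) < real m"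
    proof -
      have "2 * q + (2 * (2 * t) * m + 4 * (q + 1 - 2 * t * m)) < (8 * t + 1) * m"
        using m2 m3 a(2) fit q(2) by (simp add: algebra_simps)
      then have "real (2 * q + (2 * (2 * t) * m + 4 * (q + 1 - 2 * t * m))) < real ((8 * t + 1) * m)"
        by (simp only: of_nat_less_iff)
      then show ?thesis by (simp add: field_simps)
    qed
    \<comment> \<open>At least \<open>n / a\<close> coordinates stay free, because
      \<open>2 * t * m \<le> 24 * t * n / a = n - n / a\<close>.\<close>
    have N: "real n \<le> real a * real (q - 2 * t * (m - 1))"
    proof -
      have "2 * t * (a * m) \<le> 2 * t * (12 * n)" using m1 by (rule mult_le_mono2)
      then have "n + a * (2 * t * m) \<le> a * n" by (simp add: a(2) algebra_simps)
      moreover have "a * n \<le> a * (q - 2 * t * (m - 1)) + a * (2 * t * m)"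
      proof -
        have "2 * t * m = 2 * t * (m - 1) + 2 * t" using m3 a(1) by (cases m) auto
        then have "n \<le> q - 2 * t * (m - 1) + 2 * t * m" using fit q(2) assms(1) by linarith
        then show ?thesis unfolding distrib_left[symmetric] by (rule mult_le_mono2)
      qed
      ultimately have "n \<le> a * (q - 2 * t * (m - 1))" by linarith
      then have "real n \<le> real (a * (q - 2 * t * (m - 1)))" by (simp only: of_nat_le_iff)
      then show ?thesis by simp
    qed
    have N0: "real (q - 2 * t * (m - 1)) > 0"
    proof (rule ccontr)
      assume "\<not> real (q - 2 * t * (m - 1)) > 0"
      then have "real (q - 2 * t * (m - 1)) = 0" by linarith
      then show False using N n0 by simp
    qed
    have "2 * \<epsilon> \<le> real m * (2 * (4 * real t * real s / real (q - 2 * t * (m - 1))) ^ t)"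
      using streaming_space_tradeoff[OF dist[unfolded q(1)] space[unfolded q(1)] assms(1) fit _ \<delta>]
      by (simp add: \<epsilon>_def)
    also have "\<dots> \<le> real n * (2 * (C * real s / real n) ^ t)"
    proof -
      have "4 * real t * real s / real (q - 2 * t * (m - 1)) \<le> C * real s / real n"
      proof -
        define M where "M = real (q - 2 * t * (m - 1))"
        have "4 * real t * real s * real n \<le> 4 * real t * real s * (real a * M)"
          using N unfolding M_def by (intro mult_left_mono) auto
        moreover have "M > 0" using N0 by (simp only: M_def)
        ultimately show ?thesis using n0 unfolding M_def[symmetric] by (simp add: C_def field_simps)
      qed
      then show ?thesis using \<open>m \<le> n\<close>
        by (intro mult_mono mult_left_mono power_mono) auto
    qed
    also have "\<dots> < real n * (2 * (\<epsilon> / real n))"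
    proof -
      have "C * real s / real n < C * (c * real n powr (1 - 1 / real t)) / real n"
        using less pos n0 by (intro divide_strict_right_mono mult_strict_left_mono) auto
      also have "\<dots> = (\<epsilon> / real n) powr (1 / real t)"
        using pos n0 by (simp add: c_def powr_diff powr_divide)
      finally have "(C * real s / real n) ^ t < ((\<epsilon> / real n) powr (1 / real t)) ^ t"
        using pos assms(1) by (intro power_strict_mono) auto
      also have "\<dots> = \<epsilon> / real n"
        using pos n0 assms(1) by (simp add: powr_realpow[symmetric] powr_powr)
      finally show ?thesis using n0 by (intro mult_strict_left_mono) auto
    qed
    also have "\<dots> = 2 * \<epsilon>" using n0 by simp
    finally show False by simp
  qed
  then have "\<forall>\<^sub>F n in sequentially. \<forall>(A :: streaming_alg) (s :: nat).
           distinguishes_connected p (1 / (8 * real t + 1)) A {..<4 * n} \<and>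
           uses_space A {..<4 * n} s \<longrightarrow> real s \<ge> c * real n powr (1 - 1 / real t)"
    by (intro eventually_sequentiallyI[of "a\<^sup>2"]) blast
  with pos(3) show ?thesis by blast
qed

end
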